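(* Fix $\beta>0$. For every $\epsilon\in(0,\frac{1}{14})$ there exists $c>0$ such that, for all sufficiently large $n$, $$\mathbb{P}\bigg(\Big(|e^{i\theta_j}-i|\le n^{-\frac12+\epsilon}\ \text{for all } j\in\{1,\ldots,n\}\Big)\ \text{or}\ \Big(|e^{i\theta_j}+i|\le n^{-\frac12+\epsilon}\ \text{for all } j\in\{1,\ldots,n\}\Big)\bigg)\ \ge\ 1-e^{-cn^{2\epsilon}},$$ where $(\theta_1,\ldots,\theta_n)$ is distributed according to the mirror-type point process with parameters $n$ and $\beta$.
   Context: For $n\in\mathbb{N}_{>0}$ and $\beta>0$, the mirror-type point process is the probability measure on $(-\pi,\pi]^n$ given by $$\frac{1}{Z_n}\prod_{1\le j<k\le n}|e^{i\theta_j}-e^{-i\theta_k}|^{\beta}\prod_{j=1}^n d\theta_j,\qquad \theta_1,\ldots,\theta_n\in(-\pi,\pi],$$ where $Z_n$ is the normalization constant and $\mathbb{P}$ denotes probability with respect to this measure. *)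

theory Defs
  imports "HOL-Probability.Probability"
begin

definition mirror_weight :: "real \<Rightarrow> nat \<Rightarrow> (nat \<Rightarrow> real) \<Rightarrow> real" where
  "mirror_weight \<beta> n \<theta> =
     (\<Prod>j\<in>{1..n}. \<Prod>k\<in>{j<..n}. cmod (cis (\<theta> j) - cis (- \<theta> k)) powr \<beta>)"

text \<open>Lebesgue measure on \<open>(-\<pi>, \<pi>]\<^sup>n\<close>. Its points are functions on the index set
  \<open>{1..n}\<close>, taking the value \<^const>\<open>undefined\<close> outside it.\<close>

definition angle_lborel :: "nat \<Rightarrow> (nat \<Rightarrow> real) measure" where
  "angle_lborel n = (\<Pi>\<^sub>M j\<in>{1..n}. restrict_space lborel {-pi<..pi})"

definition mirror_Z :: "real \<Rightarrow> nat \<Rightarrow> real" where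
  "mirror_Z \<beta> n = (LINT \<theta>|angle_lborel n. mirror_weight \<beta> n \<theta>)"

definition mirror_process :: "real \<Rightarrow> nat \<Rightarrow> (nat \<Rightarrow> real) measure" where
  "mirror_process \<beta> n =
     density (angle_lborel n) (\<lambda>\<theta>. ennreal (1 / mirror_Z \<beta> n * mirror_weight \<beta> n \<theta>))"

end

theory Submission
  imports Defs "HOL-Real_Asymp.Real_Asymp"
begin

text \<open>
  Write \<open>t(x, y) = (1 + cos (x + y)) / 2\<close>, so that a pair of angles contributes
  \<open>(4 (1 - t(x, y))) powr (\<beta> / 2)\<close> to the density. With \<open>X = \<Sum> cos \<theta>\<^sub>j\<close> and \<open>Y = \<Sum> sin \<theta>\<^sub>j\<close>, the sum of \<open>t\<close> over
  all pairs is \<open>(n\<^sup>2 + X\<^sup>2 - Y\<^sup>2) / 4\<close> up to \<open>O(n)\<close>. As \<open>1 - t \<le> exp (- t)\<close>, the event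
  \<open>n\<^sup>2 + X\<^sup>2 - Y\<^sup>2 > K n\<close> costs a factor \<open>exp (- \<beta> K n / 16)\<close>, which for \<open>K = n powr \<epsilon>\<close> beats the crude
  lower bound for \<open>Z\<^sub>n\<close> obtained from a box of side \<open>1 / n\<close> at the maximiser.

  Off that event, \<open>\<bar>X\<bar> \<le> sqrt (K n)\<close>, and \<open>s Y \<ge> n - K\<close> for a sign \<open>s\<close>. Fix all angles but one. The conditional
  density of the remaining angle drops by \<open>exp (- \<beta> n \<delta>\<^sup>2 / 32)\<close> at distance \<open>\<delta>\<close> from \<open>s \<i>\<close>, and it is at least
  \<open>exp (- O(K log n))\<close> times the maximum on an interval at \<open>s \<pi> / 2\<close> from which small neighbourhoods of the
  zeros have been removed. A union bound over the angles and over \<open>s\<close> concludes.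
\<close>

section \<open>Pair factors and their defect\<close>

text \<open>This is the square of the cosine of \<open>(x + y) / 2\<close>: the fraction by which
  the squared modulus of a pair falls short of its maximum 4. It vanishes exactly when x + y is
  \<pi> modulo 2\<pi>.\<close>

definition pair_defect :: "real \<Rightarrow> real \<Rightarrow> real" where
  "pair_defect x y = (1 + cos (x + y)) / 2"

lemma pair_defect_bounds: "0 \<le> pair_defect x y" "pair_defect x y \<le> 1"
  using cos_ge_minus_one[of "x+y"] cos_le_one[of "x+y"]
  by (simp_all add: pair_defect_def del: cos_ge_minus_one cos_le_one)

lemma cmod_cis_diff_sq: "(cmod (cis x - cis y))\<^sup>2 = 2 - 2 * cos (x - y)"
proof -
  have "(cmod (cis x - cis y))\<^sup>2 = (cos x - cos y)\<^sup>2 + (sin x - sin y)\<^sup>2"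
    by (simp add: cmod_power2)
  also have "\<dots> = ((sin x)\<^sup>2 + (cos x)\<^sup>2) + ((sin y)\<^sup>2 + (cos y)\<^sup>2)
      - 2 * (cos x * cos y + sin x * sin y)"
    by (simp add: power2_eq_square algebra_simps)
  also have "\<dots> = 2 - 2 * cos (x - y)"
    by (simp only: sin_cos_squared_add cos_diff)
  finally show ?thesis .
qed

lemma cmod_mirror_sq: "(cmod (cis x - cis (- y)))\<^sup>2 = 4 * (1 - pair_defect x y)"
  unfolding cmod_cis_diff_sq by (simp add: pair_defect_def field_simps)

lemma powr_half_square: "a \<ge> 0 \<Longrightarrow> a powr b = (a\<^sup>2) powr (b / 2)" for a b :: real
  \<comment> \<open>At \<open>a = 0\<close> both sides are 0, because \<open>0 powr b = 0\<close>
    for every \<open>b\<close>.\<close>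
  by (cases "a = 0") (auto simp: powr_def ln_realpow)

lemma mirror_factor_eq:
  "cmod (cis x - cis (- y)) powr \<beta> = 2 powr \<beta> * (1 - pair_defect x y) powr (\<beta> / 2)"
proof -
  have "cmod (cis x - cis (- y)) powr \<beta> = (4 * (1 - pair_defect x y)) powr (\<beta> / 2)"
    using powr_half_square[of "cmod (cis x - cis (- y))"] by (simp only: cmod_mirror_sq norm_ge_zero)
  also have "\<dots> = (2\<^sup>2) powr (\<beta> / 2) * (1 - pair_defect x y) powr (\<beta> / 2)"
    using pair_defect_bounds[of x y] by (subst powr_mult) auto
  also have "(2\<^sup>2) powr (\<beta> / 2) = 2 powr \<beta>"
    by (rule powr_half_square[symmetric]) simp
  finally show ?thesis .
qed

lemma mirror_factor_le:
  assumes "\<beta> \<ge> 0"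
  shows "cmod (cis x - cis (- y)) powr \<beta> \<le> 2 powr \<beta> * exp (- (\<beta> / 2) * pair_defect x y)"
proof -
  have "(1 - pair_defect x y) powr (\<beta> / 2) \<le> exp (- pair_defect x y) powr (\<beta> / 2)"
    using exp_ge_add_one_self[of "- pair_defect x y"] pair_defect_bounds[of x y] assms
    by (intro powr_mono2) auto
  also have "\<dots> = exp (- (\<beta> / 2) * pair_defect x y)"
    by (simp add: powr_def)
  finally show ?thesis
    unfolding mirror_factor_eq by (intro mult_left_mono) auto
qed

text \<open>By convexity, \<open>exp\<close> at \<open>- 2 * t\<close> lies below its chord over
  [-1, 0]. Replacing the chord's left end value \<open>exp (- 1)\<close> by the larger 1/2 turns the
  chord into 1 - t.\<close>

lemma one_minus_ge_exp:
  fixes t :: real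
  assumes "0 \<le> t" "t \<le> 1 / 2"
  shows "exp (- 2 * t) \<le> 1 - t"
proof -
  have "exp (- 2 * t) = exp ((1 - 2 * t) *\<^sub>R 0 + (2 * t) *\<^sub>R (-1))" by simp
  also have "\<dots> \<le> (1 - 2 * t) * exp 0 + (2 * t) * exp (- 1)"
    using assms by (intro convex_onD[OF exp_convex]) auto
  also have "exp (- 1 :: real) \<le> 1 / 2"
    using exp_ge_add_one_self[of "1 :: real"] by (simp add: exp_minus field_simps)
  then have "(1 - 2 * t) * exp 0 + (2 * t) * exp (- 1) \<le> (1 - 2 * t) + (2 * t) * (1 / 2)"
    using assms by (intro add_mono mult_left_mono) auto
  finally show ?thesis by simp
qed

text \<open>The constant \<open>ln (4 / \<rho>\<^sup>2) \<ge> 1\<close> makes one linear bound serve both \<open>t \<le> 1/2\<close>, where \<open>1 - t \<ge> exp (- 2 t)\<close>,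
  and \<open>t > 1/2\<close>, where only \<open>4 (1 - t) \<ge> \<rho>\<^sup>2\<close> is known.\<close>

lemma mirror_factor_ge:
  assumes "\<beta> \<ge> 0" "0 < \<rho>" "\<rho> \<le> 1" "\<rho> \<le> cmod (cis x - cis (- y))"
  shows "2 powr \<beta> * exp (- \<beta> * ln (4 / \<rho>\<^sup>2) * pair_defect x y)
           \<le> cmod (cis x - cis (- y)) powr \<beta>"
proof -
  define t where "t = pair_defect x y"
  define l where "l = ln (4 / \<rho>\<^sup>2)"
  have t: "0 \<le> t" "t \<le> 1" using pair_defect_bounds by (auto simp: t_def)
  have "\<rho>\<^sup>2 \<le> 1" using assms by (simp add: power_le_one)
  have "exp 1 \<le> (4 :: real)" using exp_le by linarith
  also have "4 \<le> 4 / \<rho>\<^sup>2" using \<open>\<rho>\<^sup>2 \<le> 1\<close> assms by (simp add: field_simps)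
  finally have l: "1 \<le> l" unfolding l_def using assms by (subst ln_ge_iff) auto
  have "\<rho>\<^sup>2 \<le> 4 * (1 - t)"
    unfolding t_def cmod_mirror_sq[symmetric] using assms by (intro power_mono) auto
  then have "exp (- l) \<le> 1 - t"
    unfolding l_def exp_minus using assms by (simp add: field_simps)
  moreover have "exp (- 2 * l * t) \<le> exp (- l)" if "t > 1/2"
    using that l mult_left_mono[of 1 "2 * t" l] by (simp add: mult_ac)
  moreover have "exp (- 2 * l * t) \<le> exp (- 2 * t)"
    using mult_right_mono[OF l t(1)] by simp
  moreover have "exp (- 2 * t) \<le> 1 - t" if "t \<le> 1/2"
    using one_minus_ge_exp[OF t(1) that] .
  ultimately have "exp (- 2 * l * t) \<le> 1 - t"
    by (meson not_le order.trans)
  then have "exp (- 2 * l * t) powr (\<beta> / 2) \<le> (1 - t) powr (\<beta> / 2)"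
    using assms by (intro powr_mono2) auto
  also have "exp (- 2 * l * t) powr (\<beta> / 2) = exp (- \<beta> * l * t)"
    by (simp add: powr_def algebra_simps)
  finally show ?thesis
    unfolding mirror_factor_eq t_def l_def by (intro mult_left_mono) auto
qed

lemma cos_ge_one_minus_square: "1 - x\<^sup>2 / 2 \<le> cos x" for x :: real
proof -
  have "(sin (x / 2))\<^sup>2 \<le> (x / 2)\<^sup>2"
    using abs_sin_x_le_abs_x[of "x / 2"] by (simp only: abs_le_square_iff)
  then show ?thesis using cos_double_sin[of "x / 2"] by (simp add: power_divide)
qed

section \<open>Sums and products over pairs of indices\<close>

text \<open>Collects every pair that contains \<open>i\<close> into the first product. The second
  one is then constant in the i-th angle, which is what conditioning on the other angles
  requires.\<close>

lemma prod_ordered_pairs_split: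
  fixes g :: "nat \<Rightarrow> nat \<Rightarrow> 'a :: comm_monoid_mult"
  assumes "i \<in> {1..n}" and sym: "\<And>j k. g j k = g k j"
  shows "(\<Prod>j\<in>{1..n}. \<Prod>k\<in>{j<..n}. g j k)
    = (\<Prod>k\<in>{1..n} - {i}. g i k) * (\<Prod>j\<in>{1..n} - {i}. \<Prod>k\<in>{j<..n} - {i}. g j k)"
proof -
  let ?J = "{1..n} - {i}"
  \<comment> \<open>Row \<open>j\<close> contains the pair with \<open>i\<close> only if j < i;
    symmetry of \<open>g\<close> then puts \<open>i\<close> in first place.\<close>
  have "(\<Prod>k\<in>{j<..n}. g j k) = (if j < i then g i j else 1) * (\<Prod>k\<in>{j<..n} - {i}. g j k)"
    if "j \<in> ?J" for j
    using that assms(1) sym[of i j] prod.remove[of "{j<..n}" i "g j"] by auto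
  then have "(\<Prod>j\<in>?J. \<Prod>k\<in>{j<..n}. g j k)
      = (\<Prod>j\<in>?J. if j < i then g i j else 1) * (\<Prod>j\<in>?J. \<Prod>k\<in>{j<..n} - {i}. g j k)"
    by (simp add: prod.distrib)
  moreover have "(\<Prod>j\<in>?J. if j < i then g i j else 1) = (\<Prod>j\<in>?J \<inter> {..<i}. g i j)"
    by (subst prod.inter_restrict) auto
  moreover have "(\<Prod>j\<in>?J. g i j) = (\<Prod>j\<in>?J \<inter> {..<i}. g i j) * (\<Prod>j\<in>{i<..n}. g i j)"
    using assms(1) by (subst prod.union_disjoint[symmetric]) (auto intro!: prod.cong)
  moreover have "(\<Prod>j\<in>{1..n}. \<Prod>k\<in>{j<..n}. g j k)
      = (\<Prod>k\<in>{i<..n}. g i k) * (\<Prod>j\<in>?J. \<Prod>k\<in>{j<..n}. g j k)"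
    using assms(1) by (intro prod.remove) auto
  ultimately show ?thesis by (simp add: ac_simps)
qed

text \<open>Passing from j < k to the full square makes the sum factorise. Raising \<open>n\<close>
  adds one row, one column and one diagonal entry to the square.\<close>

lemma double_sum_ordered_pairs:
  fixes h :: "nat \<Rightarrow> nat \<Rightarrow> real"
  assumes sym: "\<And>j k. h j k = h k j"
  shows "2 * (\<Sum>j\<in>{1..n}. \<Sum>k\<in>{j<..n}. h j k) + (\<Sum>j\<in>{1..n}. h j j)
    = (\<Sum>j\<in>{1..n}. \<Sum>k\<in>{1..n}. h j k)"
proof (induction n)
  case (Suc n)
  have "(\<Sum>j\<in>{1..n}. \<Sum>k\<in>{j<..Suc n}. h j k)
      = (\<Sum>j\<in>{1..n}. h j (Suc n) + (\<Sum>k\<in>{j<..n}. h j k))"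
  proof (intro sum.cong refl)
    fix j assume "j \<in> {1..n}"
    then have "{j<..Suc n} = insert (Suc n) {j<..n}" by auto
    then show "(\<Sum>k\<in>{j<..Suc n}. h j k) = h j (Suc n) + (\<Sum>k\<in>{j<..n}. h j k)" by simp
  qed
  moreover have "(\<Sum>k\<in>{1..n}. h (Suc n) k) = (\<Sum>j\<in>{1..n}. h j (Suc n))"
    using sym by (intro sum.cong) auto
  ultimately show ?case using Suc by (simp add: sum.distrib algebra_simps)
qed simp

text \<open>Over the full square the cosine addition formula splits the double sum into squares of
  single sums. The correction comes from the diagonal, where the defect is the squared
  cosine.\<close>

lemma sum_pair_defect:
  "(\<Sum>j\<in>{1..n}. \<Sum>k\<in>{j<..n}. pair_defect (\<theta> j) (\<theta> k))
    = ((real n)\<^sup>2 + (\<Sum>j\<in>{1..n}. cos (\<theta> j))\<^sup>2 - (\<Sum>j\<in>{1..n}. sin (\<theta> j))\<^sup>2) / 4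
      - (\<Sum>j\<in>{1..n}. (cos (\<theta> j))\<^sup>2) / 2"
proof -
  have "(\<Sum>j\<in>{1..n}. \<Sum>k\<in>{1..n}. pair_defect (\<theta> j) (\<theta> k))
      = ((real n)\<^sup>2 + (\<Sum>j\<in>{1..n}. cos (\<theta> j))\<^sup>2 - (\<Sum>j\<in>{1..n}. sin (\<theta> j))\<^sup>2) / 2"
    by (simp add: pair_defect_def cos_add sum.distrib sum_subtractf sum_divide_distrib[symmetric]
        power2_eq_square sum_product)
  moreover have "pair_defect (\<theta> j) (\<theta> j) = (cos (\<theta> j))\<^sup>2" for j
    by (simp add: pair_defect_def cos_double_cos flip: mult_2)
  moreover have "pair_defect (\<theta> j) (\<theta> k) = pair_defect (\<theta> k) (\<theta> j)" for j k
    by (simp add: pair_defect_def add.commute)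
  ultimately show ?thesis
    using double_sum_ordered_pairs[of "\<lambda>j k. pair_defect (\<theta> j) (\<theta> k)" n]
    by (simp only: mult_2 field_sum_of_halves) linarith
qed

section \<open>Bounds on the joint weight\<close>

text \<open>The weight at the point where all angles are \<pi>/2, and its maximum for \<beta> \<ge>
  0. It serves as a common scale that cancels against the lower bound for
  \<open>mirror_Z\<close>.\<close>

definition mirror_max :: "real \<Rightarrow> nat \<Rightarrow> real" where
  "mirror_max \<beta> n = (\<Prod>j\<in>{1..n}. \<Prod>k\<in>{j<..n}. 2 powr \<beta>)"

lemma mirror_max_pos: "mirror_max \<beta> n > 0"
  by (auto simp: mirror_max_def intro!: prod_pos)

lemma prod_scaled_exp: "(\<Prod>k\<in>A. c * exp (f k)) = (\<Prod>k\<in>A. c) * exp (\<Sum>k\<in>A. f k)"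
  if "finite A" for c :: real
  using that by (simp add: prod.distrib exp_sum)

lemma mirror_weight_le:
  assumes "\<beta> \<ge> 0"
  shows "mirror_weight \<beta> n \<theta> \<le> mirror_max \<beta> n *
    exp (- (\<beta> / 2) * (\<Sum>j\<in>{1..n}. \<Sum>k\<in>{j<..n}. pair_defect (\<theta> j) (\<theta> k)))"
proof -
  have "mirror_weight \<beta> n \<theta> \<le>
      (\<Prod>j\<in>{1..n}. \<Prod>k\<in>{j<..n}. 2 powr \<beta> * exp (- (\<beta> / 2) * pair_defect (\<theta> j) (\<theta> k)))"
    unfolding mirror_weight_def
    by (intro prod_mono conjI prod_nonneg ballI mirror_factor_le assms powr_ge_zero)
  also have "\<dots> = mirror_max \<beta> n *
    exp (\<Sum>j\<in>{1..n}. \<Sum>k\<in>{j<..n}. - (\<beta> / 2) * pair_defect (\<theta> j) (\<theta> k))"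
    unfolding mirror_max_def
    by (subst prod_scaled_exp, simp, subst prod.distrib, subst (2) exp_sum, auto)
  finally show ?thesis by (simp only: sum_distrib_left)
qed

lemma mirror_weight_nonneg: "mirror_weight \<beta> n \<theta> \<ge> 0"
  by (auto simp: mirror_weight_def intro!: prod_nonneg)

lemma mirror_weight_le_max: "\<beta> \<ge> 0 \<Longrightarrow> mirror_weight \<beta> n \<theta> \<le> mirror_max \<beta> n"
  using mirror_weight_le[of \<beta> n \<theta>] mirror_max_pos[of \<beta> n]
  by (smt (verit) exp_le_one_iff mult_left_le mult_nonneg_nonneg pair_defect_bounds sum_nonneg divide_nonneg_nonneg mult_minus_left)

text \<open>The hypothesis puts more than K n / 4 into the total defect before the diagonal
  correction. That correction is at most n / 2, hence at most K n / 8 as K \<ge> 4. The remaining K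
  n / 8 times \<beta>/2 gives the exponent.\<close>

lemma mirror_weight_le_spread:
  fixes K :: real
  assumes "\<beta> \<ge> 0" "K \<ge> 4"
    and "(real n)\<^sup>2 - (\<Sum>j\<in>{1..n}. sin (\<theta> j))\<^sup>2 + (\<Sum>j\<in>{1..n}. cos (\<theta> j))\<^sup>2 > K * n"
  shows "mirror_weight \<beta> n \<theta> \<le> mirror_max \<beta> n * exp (- \<beta> * K * n / 16)"
proof -
  let ?S = "\<Sum>j\<in>{1..n}. \<Sum>k\<in>{j<..n}. pair_defect (\<theta> j) (\<theta> k)"
  have "(\<Sum>j\<in>{1..n}. (cos (\<theta> j))\<^sup>2) \<le> (\<Sum>j\<in>{1..n}. 1)"
    by (intro sum_mono) (simp add: abs_square_le_1)
  then have "(\<Sum>j\<in>{1..n}. (cos (\<theta> j))\<^sup>2) \<le> n" by simp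
  moreover have "4 * real n \<le> K * n" using assms by (intro mult_right_mono) auto
  moreover have "k / 8 \<le> (a + b - c) / 4 - d / 2"
    if "d \<le> m" "4 * m \<le> k" "k < a - c + b" for a b c d k m :: real
    using that by argo
  ultimately have "?S \<ge> K * n / 8" unfolding sum_pair_defect using assms(3) by blast
  then have "- (\<beta> / 2) * ?S \<le> - \<beta> * K * n / 16"
    using assms mult_left_mono[of "K * n / 8" ?S "\<beta> / 2"] by simp
  then have "mirror_max \<beta> n * exp (- (\<beta> / 2) * ?S) \<le> mirror_max \<beta> n * exp (- \<beta> * K * n / 16)"
    using mirror_max_pos[of \<beta> n] by (intro mult_left_mono) auto
  with mirror_weight_le[OF assms(1), of n \<theta>] show ?thesis by linarith
qed

text \<open>In the box every sum of two angles is within 2/n of \<pi>, so each defect is at most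
  1/n^2. As there are fewer than n^2 pairs, the total loss in the exponent is bounded independently
  of n.\<close>

lemma mirror_weight_ge_box:
  assumes "\<beta> \<ge> 0" "n \<ge> 2" and box: "\<And>j. j \<in> {1..n} \<Longrightarrow> \<theta> j \<in> {pi / 2..pi / 2 + 1 / n}"
  shows "mirror_max \<beta> n * exp (- 2 * \<beta>) \<le> mirror_weight \<beta> n \<theta>"
proof -
  have d: "pair_defect (\<theta> j) (\<theta> k) \<le> 1 / n\<^sup>2" if jk: "j \<in> {1..n}" "k \<in> {j<..n}" for j k
  proof -
    define y where "y = \<theta> j + \<theta> k - pi"
    have "\<theta> j \<in> {pi / 2..pi / 2 + 1 / n}" "\<theta> k \<in> {pi / 2..pi / 2 + 1 / n}"
      using jk by (intro box, simp)+
    then have y: "0 \<le> y" "y \<le> 2 / n" by (auto simp: y_def field_simps)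
    have "cos (\<theta> j + \<theta> k) = - cos y"
      by (simp add: y_def cos_diff)
    moreover have "1 - y\<^sup>2 / 2 \<le> cos y" by (rule cos_ge_one_minus_square)
    moreover have "y\<^sup>2 \<le> (2 / n)\<^sup>2" using y by (intro power_mono) auto
    ultimately show ?thesis by (simp add: pair_defect_def power_divide field_simps)
  qed
  have "2 powr \<beta> * exp (- \<beta> * ln 4 * (1 / n\<^sup>2)) \<le> cmod (cis (\<theta> j) - cis (- \<theta> k)) powr \<beta>"
    if jk: "j \<in> {1..n}" "k \<in> {j<..n}" for j k
  proof -
    \<comment> \<open>For n \<ge> 2 the defect is at most 1/4, so the modulus is at least 1 and
      \<open>mirror_factor_ge\<close> applies with \<rho> = 1, which gives the constant
      \<open>ln 4\<close>.\<close>
    have "2\<^sup>2 \<le> (real n)\<^sup>2" using assms(2) by (intro power_mono) auto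
    then have "1 / (real n)\<^sup>2 \<le> 1 / 2\<^sup>2" by (intro frac_le) auto
    then have "1 \<le> (cmod (cis (\<theta> j) - cis (- \<theta> k)))\<^sup>2"
      using d[OF jk] unfolding cmod_mirror_sq by simp
    then have "1 \<le> cmod (cis (\<theta> j) - cis (- \<theta> k))"
      by (metis norm_ge_zero one_le_power power2_le_imp_le power_one)
    from mirror_factor_ge[OF assms(1) _ _ this]
    have "2 powr \<beta> * exp (- \<beta> * ln 4 * pair_defect (\<theta> j) (\<theta> k))
        \<le> cmod (cis (\<theta> j) - cis (- \<theta> k)) powr \<beta>" by simp
    moreover have "\<beta> * ln 4 * pair_defect (\<theta> j) (\<theta> k) \<le> \<beta> * ln 4 * (1 / n\<^sup>2)"
      using d[OF jk] assms(1) by (intro mult_left_mono) auto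
    then have "2 powr \<beta> * exp (- \<beta> * ln 4 * (1 / n\<^sup>2))
        \<le> 2 powr \<beta> * exp (- \<beta> * ln 4 * pair_defect (\<theta> j) (\<theta> k))"
      by (intro mult_left_mono) auto
    ultimately show ?thesis by linarith
  qed
  then have "(\<Prod>j\<in>{1..n}. \<Prod>k\<in>{j<..n}. 2 powr \<beta> * exp (- \<beta> * ln 4 * (1 / n\<^sup>2)))
      \<le> mirror_weight \<beta> n \<theta>"
    unfolding mirror_weight_def by (intro prod_mono conjI prod_nonneg ballI) auto
  moreover have "(\<Prod>j\<in>{1..n}. \<Prod>k\<in>{j<..n}. 2 powr \<beta> * exp (- \<beta> * ln 4 * (1 / n\<^sup>2)))
      = mirror_max \<beta> n * exp (\<Sum>j\<in>{1..n}. \<Sum>k\<in>{j<..n}. - \<beta> * ln 4 * (1 / n\<^sup>2))"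
    unfolding mirror_max_def
    by (subst prod_scaled_exp, simp, subst prod.distrib, subst (2) exp_sum, auto)
  \<comment> \<open>Extending the sum of these nonpositive terms to all n^2 index pairs only lowers
    it, and the extended sum is free of n.\<close>
  moreover have "(\<Sum>j\<in>{1..n}. \<Sum>k\<in>{j<..n}. - \<beta> * ln 4 * (1 / n\<^sup>2))
      \<ge> (\<Sum>j\<in>{1..n}. \<Sum>k\<in>{1..n}. - \<beta> * ln 4 * (1 / n\<^sup>2))"
  proof (intro sum_mono)
    fix j assume "j \<in> {1..n}"
    have "(\<Sum>k\<in>{j<..n}. \<beta> * ln 4 * (1 / n\<^sup>2)) \<le> (\<Sum>k\<in>{1..n}. \<beta> * ln 4 * (1 / n\<^sup>2))"
      using assms(1) by (intro sum_mono2) auto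
    then show "(\<Sum>k\<in>{1..n}. - \<beta> * ln 4 * (1 / n\<^sup>2)) \<le> (\<Sum>k\<in>{j<..n}. - \<beta> * ln 4 * (1 / n\<^sup>2))"
      by (simp add: sum_negf)
  qed
  moreover have "(\<Sum>j\<in>{1..n}. \<Sum>k\<in>{1..n}. - \<beta> * ln 4 * (1 / n\<^sup>2)) = - \<beta> * ln 4"
    using assms(2) by (simp add: power2_eq_square)
  moreover have "\<beta> * ln 4 \<le> \<beta> * 2"
  proof (intro mult_left_mono assms(1))
    show "ln 4 \<le> (2 :: real)"
      using ln_add_one_self_le_self2[of "1::real"] ln_realpow[of "2::real" 2] by simp
  qed
  ultimately have "mirror_max \<beta> n * exp (- 2 * \<beta>)
      \<le> (\<Prod>j\<in>{1..n}. \<Prod>k\<in>{j<..n}. 2 powr \<beta> * exp (- \<beta> * ln 4 * (1 / n\<^sup>2)))"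
    using mirror_max_pos[of \<beta> n] by (simp only:) (intro mult_left_mono, auto)
  then show ?thesis
    using \<open>_ \<le> mirror_weight \<beta> n \<theta>\<close> by linarith
qed

section \<open>The weight as a function of one angle\<close>

lemma sum_pair_defect_slice:
  assumes "finite J"
  shows "(\<Sum>k\<in>J. pair_defect y (x k))
    = (card J + cos y * (\<Sum>k\<in>J. cos (x k)) - sin y * (\<Sum>k\<in>J. sin (x k))) / 2"
  using assms by (simp add: pair_defect_def cos_add sum.distrib sum_subtractf
      sum_divide_distrib[symmetric] sum_distrib_left)

lemma cmod_cis_diff_pole_sq:
  assumes "s = 1 \<or> s = - 1"
  shows "(cmod (cis y - complex_of_real s * \<i>))\<^sup>2 = 2 * (1 - s * sin y)"
proof -
  have "(cmod (cis y - complex_of_real s * \<i>))\<^sup>2 = (cos y)\<^sup>2 + (sin y - s)\<^sup>2"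
    by (simp add: cmod_power2)
  also have "\<dots> = ((sin y)\<^sup>2 + (cos y)\<^sup>2) + s\<^sup>2 - 2 * s * sin y"
    by (simp add: power2_eq_square algebra_simps)
  also have "\<dots> = 2 * (1 - s * sin y)" using assms by auto
  finally show ?thesis .
qed

text \<open>With v = s sin y and d the distance from \<open>cis y\<close> to the pole, d^2 = 2 (1 -
  v). Twice the total defect has main term (n - 1)(1 - v) \<ge> n d^2 / 4. The sums deviate from
  their ideal values 0 and s (n - 1), which costs at most n d^2 / 16 for the cosines and n
  \<delta>^2 / 16 for the sines. Since d > \<delta>, at least n \<delta>^2 / 8 is left.\<close>

lemma mirror_slice_le:
  fixes x :: "'a \<Rightarrow> real" and L M \<delta> s :: real
  assumes "\<beta> \<ge> 0" and J: "finite J" "card J + 1 = n" and "n \<ge> 2"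
    and s: "s = 1 \<or> s = - 1"
    and L: "\<bar>\<Sum>k\<in>J. cos (x k)\<bar> \<le> L" and M: "s * (\<Sum>k\<in>J. sin (x k)) \<ge> n - M"
    and params: "1 \<le> M" "M \<le> n" "L \<le> n * \<delta> / 16" "M \<le> n * \<delta>\<^sup>2 / 16" "\<delta> > 0"
    and far: "cmod (cis y - complex_of_real s * \<i>) > \<delta>"
  shows "(\<Prod>k\<in>J. cmod (cis y - cis (- x k)) powr \<beta>)
    \<le> (\<Prod>k\<in>J. 2 powr \<beta>) * exp (- \<beta> * n * \<delta>\<^sup>2 / 32)"
proof -
  define X Y where "X = (\<Sum>k\<in>J. cos (x k))" and "Y = (\<Sum>k\<in>J. sin (x k))"
  define d v where "d = cmod (cis y - complex_of_real s * \<i>)" and "v = s * sin y"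
  let ?T = "\<Sum>k\<in>J. pair_defect y (x k)"
  have d2: "d\<^sup>2 = 2 * (1 - v)" unfolding d_def v_def using cmod_cis_diff_pole_sq[OF s] .
  have v: "\<bar>v\<bar> \<le> 1" using s by (auto simp: v_def)
  have n: "real (card J) = real n - 1" using J by linarith
  have "\<bar>Y\<bar> \<le> (\<Sum>k\<in>J. 1)" unfolding Y_def by (intro order.trans[OF sum_abs] sum_mono) auto
  then have Y: "s * Y \<le> real n - 1" "s * Y \<ge> n - M" using s n M by (auto simp: Y_def)
  \<comment> \<open>\<open>s * Y\<close> lies between n - M and n - 1. The upper end is extremal for
    v \<ge> 0 and the lower end for v < 0; the gap M - 1 covers both cases.\<close>
  have vY: "v * (s * Y) \<le> v * (real n - 1) + (M - 1)"
  proof (cases "v \<ge> 0")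
    case True
    then show ?thesis using Y params mult_left_mono[of "s * Y" "real n - 1" v] by linarith
  next
    case False
    then have "v * (s * Y) \<le> v * (n - M)" using Y by (intro mult_left_mono_neg) auto
    also have "\<dots> = v * (real n - 1) + (- v) * (M - 1)" by (simp add: algebra_simps)
    also have "(- v) * (M - 1) \<le> 1 * (M - 1)" using v params by (intro mult_right_mono) auto
    finally show ?thesis by simp
  qed
  have sY: "sin y * Y = v * (s * Y)" using s by (auto simp: v_def)
  \<comment> \<open>The cosine vanishes at the pole and is bounded by the distance d. So the cosine
    term is only linear in d, and L \<le> n \<delta> / 16 with \<delta> < d makes it
    quadratic.\<close>
  have "(cos y)\<^sup>2 = 1 - v\<^sup>2"
    using s by (auto simp: v_def cos_squared_eq)
  also have "\<dots> = (1 - v) * (1 + v)" by (simp add: power2_eq_square algebra_simps)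
  also have "\<dots> \<le> (1 - v) * 2" using v by (intro mult_left_mono) auto
  finally have "(cos y)\<^sup>2 \<le> d\<^sup>2" using d2 by simp
  then have "\<bar>cos y\<bar> \<le> d" unfolding abs_le_square_iff[symmetric] by (simp add: d_def)
  then have "\<bar>cos y * X\<bar> \<le> d * L"
    unfolding abs_mult using L by (intro mult_mono) (auto simp: X_def d_def)
  also have "\<dots> \<le> d * (n * \<delta> / 16)" using params by (intro mult_left_mono) (auto simp: d_def)
  also have "\<dots> = (n * d / 16) * \<delta>" by simp
  also have "\<dots> \<le> (n * d / 16) * d" using far by (intro mult_left_mono) (auto simp: d_def)
  finally have cX: "\<bar>cos y * X\<bar> \<le> n * d\<^sup>2 / 16" by (simp add: power2_eq_square)
  have \<delta>d: "n * \<delta>\<^sup>2 \<le> n * d\<^sup>2"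
    using far params by (intro mult_left_mono power_mono) (auto simp: d_def)
  have "(real n - 1) * (1 - v) \<ge> (n / 2) * (1 - v)"
    using \<open>n \<ge> 2\<close> v by (intro mult_right_mono) auto
  moreover have "n * d\<^sup>2 / 4 = (n / 2) * (1 - v)" unfolding d2 by simp
  ultimately have "(real n - 1) * (1 - v) \<ge> n * d\<^sup>2 / 4" by linarith
  moreover have "2 * ?T = (real n - 1) + cos y * X - v * (s * Y)"
    unfolding sum_pair_defect_slice[OF J(1)] n X_def[symmetric] Y_def[symmetric] sY by simp
  moreover have "(real n - 1) * (1 - v) = (real n - 1) - v * (real n - 1)"
    using \<open>n \<ge> 2\<close> by (simp add: algebra_simps)
  ultimately have "2 * ?T \<ge> n * \<delta>\<^sup>2 / 8"
    using vY cX \<delta>d params unfolding abs_le_iff by argo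
  then have "exp (- (\<beta> / 2) * ?T) \<le> exp (- \<beta> * n * \<delta>\<^sup>2 / 32)"
    using \<open>\<beta> \<ge> 0\<close> mult_left_mono[of "n * \<delta>\<^sup>2 / 16" ?T "\<beta> / 2"] by simp
  moreover have "(\<Prod>k\<in>J. cmod (cis y - cis (- x k)) powr \<beta>)
      \<le> (\<Prod>k\<in>J. 2 powr \<beta> * exp (- (\<beta> / 2) * pair_defect y (x k)))"
    using \<open>\<beta> \<ge> 0\<close> by (intro prod_mono conjI mirror_factor_le powr_ge_zero)
  moreover have "\<dots> = (\<Prod>k\<in>J. 2 powr \<beta>) * exp (- (\<beta> / 2) * ?T)"
    by (simp only: prod_scaled_exp[OF J(1)] sum_distrib_left)
  moreover have "0 \<le> (\<Prod>k\<in>J. 2 powr \<beta>)" by (intro prod_nonneg) auto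
  ultimately show ?thesis by (smt (verit) mult_left_mono)
qed

text \<open>Within 1/n of the pole the cosine of y is at most 1/n, so the cosine sum contributes at
  most 1. The sine term is at least n - M - 1. Twice the total defect is therefore at most M + 1,
  and the separation \<rho> from the zeros \<open>cis (- x k)\<close> lets
  \<open>mirror_factor_ge\<close> turn this into a lower bound.\<close>

lemma mirror_slice_ge:
  fixes x :: "'a \<Rightarrow> real" and L M \<rho> s :: real
  assumes "\<beta> \<ge> 0" and J: "finite J" "card J + 1 = n" and "n \<ge> 2"
    and s: "s = 1 \<or> s = - 1"
    and L: "\<bar>\<Sum>k\<in>J. cos (x k)\<bar> \<le> L" and M: "s * (\<Sum>k\<in>J. sin (x k)) \<ge> n - M"
    and params: "M \<le> n" "L \<le> n" "0 < \<rho>" "\<rho> \<le> 1"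
    and y: "y \<in> {s * pi / 2..s * pi / 2 + 1 / n}"
    and sep: "\<And>k. k \<in> J \<Longrightarrow> \<rho> \<le> cmod (cis y - cis (- x k))"
  shows "(\<Prod>k\<in>J. 2 powr \<beta>) * exp (- \<beta> * ln (4 / \<rho>\<^sup>2) * (M + 1) / 2)
    \<le> (\<Prod>k\<in>J. cmod (cis y - cis (- x k)) powr \<beta>)"
proof -
  define X Y where "X = (\<Sum>k\<in>J. cos (x k))" and "Y = (\<Sum>k\<in>J. sin (x k))"
  define r where "r = y - s * pi / 2"
  let ?T = "\<Sum>k\<in>J. pair_defect y (x k)"
  have r: "0 \<le> r" "r \<le> 1 / n" using y by (auto simp: r_def)
  have n: "real (card J) = real n - 1" using J by linarith
  have "y = s * pi / 2 + r" by (simp add: r_def)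
  then have cy: "cos y = - s * sin r" "sin y = s * cos r"
    using s by (auto simp: cos_add sin_add)
  have "\<bar>cos y\<bar> \<le> 1 / n" using s r abs_sin_x_le_abs_x[of r] by (auto simp: cy)
  then have "\<bar>cos y * X\<bar> \<le> (1 / n) * n"
    unfolding abs_mult using L params by (intro mult_mono) (auto simp: X_def)
  then have cX: "\<bar>cos y * X\<bar> \<le> 1" using \<open>n \<ge> 2\<close> by simp
  \<comment> \<open>The loss from replacing \<open>cos r\<close> by 1 in front of n - M: it is at
    most 1 because r \<le> 1/n.\<close>
  have "r\<^sup>2 / 2 * (n - M) \<le> 1"
  proof -
    have "0 \<le> M"
    proof -
      have "\<bar>Y\<bar> \<le> (\<Sum>k\<in>J. 1)" unfolding Y_def by (intro order.trans[OF sum_abs] sum_mono) auto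
      then show ?thesis using s n M by (auto simp: Y_def)
    qed
    then have "r\<^sup>2 / 2 * (n - M) \<le> (1 / n)\<^sup>2 / 2 * n"
      using r params by (intro mult_mono divide_right_mono power_mono) auto
    also have "\<dots> \<le> 1" using \<open>n \<ge> 2\<close> by (simp add: power2_eq_square field_simps)
    finally show ?thesis .
  qed
  moreover have "(1 - r\<^sup>2 / 2) * (n - M) \<le> cos r * (n - M)"
    using params by (intro mult_right_mono cos_ge_one_minus_square) auto
  moreover have "cos r * (n - M) \<le> cos r * (s * Y)"
  proof -
    have "r \<le> 1 / 2" using r(2) by (rule order.trans) (use \<open>n \<ge> 2\<close> in \<open>auto simp: field_simps\<close>)
    then have "0 \<le> cos r" using r pi_gt3 by (intro cos_ge_zero) auto
    then show ?thesis using M by (intro mult_left_mono) (auto simp: Y_def)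
  qed
  moreover have "sin y * Y = cos r * (s * Y)" by (simp add: cy)
  moreover have "2 * ?T = (real n - 1) + cos y * X - sin y * Y"
    unfolding sum_pair_defect_slice[OF J(1)] n X_def[symmetric] Y_def[symmetric] by simp
  ultimately have T: "2 * ?T \<le> M + 1"
    using cX unfolding left_diff_distrib abs_le_iff by argo
  have "1 \<le> 4 / \<rho>\<^sup>2" using params power_le_one[of \<rho> 2] by (simp add: field_simps)
  then have "\<beta> * ln (4 / \<rho>\<^sup>2) * ?T \<le> \<beta> * ln (4 / \<rho>\<^sup>2) * ((M + 1) / 2)"
    using T \<open>\<beta> \<ge> 0\<close> by (intro mult_left_mono mult_nonneg_nonneg ln_ge_zero) auto
  then have "(\<Prod>k\<in>J. 2 powr \<beta>) * exp (- \<beta> * ln (4 / \<rho>\<^sup>2) * (M + 1) / 2)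
      \<le> (\<Prod>k\<in>J. 2 powr \<beta>) * exp (- \<beta> * ln (4 / \<rho>\<^sup>2) * ?T)"
    by (intro mult_left_mono prod_nonneg) auto
  also have "\<dots> = (\<Prod>k\<in>J. 2 powr \<beta> * exp (- \<beta> * ln (4 / \<rho>\<^sup>2) * pair_defect y (x k)))"
    by (simp only: prod_scaled_exp[OF J(1)] sum_distrib_left)
  also have "\<dots> \<le> (\<Prod>k\<in>J. cmod (cis y - cis (- x k)) powr \<beta>)"
    using \<open>\<beta> \<ge> 0\<close> params sep by (intro prod_mono conjI mirror_factor_ge mult_nonneg_nonneg) auto
  finally show ?thesis .
qed

section \<open>Removing neighbourhoods of the zeros\<close>

text \<open>Compares chord and arc. Taylor's formula gives cos d \<le> 1 - d^2/2 + d^4/24, and d^4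
  \<le> d^2 for arcs of length at most 1, so the squared chord 2 - 2 cos d exceeds d^2/4 with room
  to spare.\<close>

lemma cmod_cis_diff_ge:
  assumes "\<bar>x - y\<bar> \<le> 1"
  shows "\<bar>x - y\<bar> / 2 \<le> cmod (cis x - cis y)"
proof -
  define d where "d = x - y"
  obtain t where "cos d = (\<Sum>m<4. cos_coeff m * d ^ m)
      + (cos (t + 1/2 * real 4 * pi) / fact 4) * d ^ 4"
    using Maclaurin_cos_expansion[of d 4] by blast
  moreover have "cos (t + 1/2 * real 4 * pi) * d ^ 4 \<le> 1 * d ^ 4"
    by (intro mult_right_mono) auto
  moreover have "(\<Sum>m<4. cos_coeff m * d ^ m) = 1 - d\<^sup>2 / 2"
    by (simp add: cos_coeff_def lessThan_nat_numeral fact_numeral)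
  ultimately have "cos d \<le> 1 - d\<^sup>2 / 2 + d ^ 4 / 24"
    by (simp add: fact_numeral)
  moreover have "d ^ 4 \<le> d\<^sup>2"
    using assms power_decreasing[of 2 4 "\<bar>d\<bar>"] by (simp add: d_def)
  moreover have "0 \<le> d\<^sup>2" by simp
  ultimately have "d\<^sup>2 / 4 \<le> 2 - 2 * cos d" by argo
  then have "(\<bar>d\<bar> / 2)\<^sup>2 \<le> 2 - 2 * cos d" by (simp add: power_divide)
  then have "(\<bar>d\<bar> / 2)\<^sup>2 \<le> (cmod (cis x - cis y))\<^sup>2"
    by (simp add: cmod_cis_diff_sq d_def)
  then show ?thesis unfolding d_def by (rule power2_le_imp_le) simp
qed

lemma closed_cis_far: "closed {y. \<rho> \<le> cmod (cis y - w)}"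
  by (intro closed_Collect_le continuous_intros)

lemma borel_cis_far_interval: "{y \<in> {a..b}. \<forall>k\<in>J. \<rho> \<le> cmod (cis y - w k)} \<in> sets borel"
proof -
  have "{y \<in> {a..b}. \<forall>k\<in>J. \<rho> \<le> cmod (cis y - w k)}
      = {a..b} \<inter> (\<Inter>k\<in>J. {y. \<rho> \<le> cmod (cis y - w k)})"
    by auto
  moreover have "closed \<dots>" by (intro closed_Int closed_INT ballI closed_cis_far) auto
  ultimately show ?thesis by (metis borel_closed)
qed

text \<open>No angle of \<open>w\<close> has to be located: any single point of the set serves as
  centre. Two points of the set have chord below 2 \<rho>, hence arc below 4 \<rho>, and the
  enclosing interval has length 8 \<rho>.\<close>

lemma emeasure_cis_near_le:
  assumes "0 \<le> h" "h \<le> 1" "\<rho> > 0"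
  shows "emeasure lborel {y \<in> {a..a + h}. cmod (cis y - w) < \<rho>} \<le> ennreal (8 * \<rho>)"
proof (cases "{y \<in> {a..a + h}. cmod (cis y - w) < \<rho>} = {}")
  case False
  then obtain y0 where y0: "y0 \<in> {a..a + h}" "cmod (cis y0 - w) < \<rho>" by auto
  have "{y \<in> {a..a + h}. cmod (cis y - w) < \<rho>} \<subseteq> {y0 - 4 * \<rho>..y0 + 4 * \<rho>}"
  proof safe
    fix y assume y: "y \<in> {a..a + h}" "cmod (cis y - w) < \<rho>"
    have "cmod (cis y - cis y0) \<le> cmod (cis y - w) + cmod (cis y0 - w)"
      using norm_triangle_ineq4[of "cis y - w" "cis y0 - w"] by simp
    moreover have "\<bar>y - y0\<bar> \<le> 1" using y y0 assms by auto
    then have "\<bar>y - y0\<bar> / 2 \<le> cmod (cis y - cis y0)" by (rule cmod_cis_diff_ge)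
    ultimately show "y \<in> {y0 - 4 * \<rho>..y0 + 4 * \<rho>}" using y y0 by auto
  qed
  then have "emeasure lborel {y \<in> {a..a + h}. cmod (cis y - w) < \<rho>}
      \<le> emeasure lborel {y0 - 4 * \<rho>..y0 + 4 * \<rho>}"
    by (intro emeasure_mono) auto
  then show ?thesis using assms by simp
next
  case True
  then show ?thesis by (simp only: emeasure_empty) simp
qed

text \<open>The separation radius is chosen so that each removed set has measure at most 1/(2 n^2).
  At most n of them are removed, so half of the interval of length 1/n survives.\<close>

lemma emeasure_cis_far_ge:
  fixes n :: nat
  assumes J: "finite J" "card J \<le> n" and "n \<ge> 1"
  shows "ennreal (1 / (2 * real n)) \<le>
    emeasure lborel {y \<in> {a..a + 1 / n}. \<forall>k\<in>J. 1 / (16 * (real n)\<^sup>2) \<le> cmod (cis y - w k)}"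
proof -
  define \<rho> where "\<rho> = 1 / (16 * (real n)\<^sup>2)"
  define G where "G = {y \<in> {a..a + 1 / n}. \<forall>k\<in>J. \<rho> \<le> cmod (cis y - w k)}"
  define B where "B k = {y \<in> {a..a + 1 / n}. cmod (cis y - w k) < \<rho>}" for k
  have [measurable]: "{y. \<rho> \<le> cmod (cis y - w k)} \<in> sets borel" for k
    using closed_cis_far by (rule borel_closed)
  have G: "G \<in> sets borel" unfolding G_def by (rule borel_cis_far_interval)
  have "B k = {a..a + 1 / n} - {y. \<rho> \<le> cmod (cis y - w k)}" for k by (auto simp: B_def)
  then have B: "B k \<in> sets borel" for k by simp
  have "ennreal (1 / n) = emeasure lborel {a..a + 1 / n}" by simp
  also have "{a..a + 1 / n} = G \<union> (\<Union>k\<in>J. B k)" by (auto simp: G_def B_def)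
  also have "emeasure lborel \<dots> \<le> emeasure lborel G + emeasure lborel (\<Union>k\<in>J. B k)"
    using G B J by (intro emeasure_subadditive sets.finite_UN) auto
  also have "emeasure lborel (\<Union>k\<in>J. B k) \<le> (\<Sum>k\<in>J. emeasure lborel (B k))"
    using B J by (intro emeasure_subadditive_finite) auto
  also have "\<dots> \<le> (\<Sum>k\<in>J. ennreal (8 * \<rho>))"
    unfolding B_def using \<open>n \<ge> 1\<close> by (intro sum_mono emeasure_cis_near_le) (auto simp: \<rho>_def)
  also have "\<dots> = ennreal (card J * (8 * \<rho>))"
    by (subst ennreal_mult) (simp_all add: \<rho>_def ennreal_of_nat_eq_real_of_nat)
  also have "\<dots> \<le> ennreal (1 / (2 * real n))"
  proof (intro ennreal_leI)
    have "card J * (8 * \<rho>) \<le> n * (8 * \<rho>)" using J by (intro mult_right_mono) (auto simp: \<rho>_def)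
    also have "\<dots> = 1 / (2 * real n)" using \<open>n \<ge> 1\<close> by (simp add: \<rho>_def power2_eq_square)
    finally show "card J * (8 * \<rho>) \<le> 1 / (2 * real n)" .
  qed
  finally have *: "ennreal (1 / n) \<le> emeasure lborel G + ennreal (1 / (2 * real n))"
    by (simp add: add_left_mono)
  have "ennreal (1 / n) = ennreal (1 / (2 * real n)) + ennreal (1 / (2 * real n))"
    by (subst ennreal_plus[symmetric]) (auto simp: field_simps)
  with * have "ennreal (1 / (2 * real n)) \<le> emeasure lborel G"
    by (simp add: ennreal_add_left_cancel_le add.commute)
  then show ?thesis by (simp add: G_def \<rho>_def)
qed

section \<open>Lebesgue measure on the angles\<close>

definition angle_measure :: "real measure" where
  "angle_measure = restrict_space lborel {-pi<..pi}"

lemma angle_lborel_eq: "angle_lborel n = (\<Pi>\<^sub>M j\<in>{1..n}. angle_measure)"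
  by (simp add: angle_lborel_def angle_measure_def)

lemma space_angle_measure [simp]: "space angle_measure = {-pi<..pi}"
  by (simp add: angle_measure_def space_restrict_space)

lemma sets_angle_measure [measurable_cong]: "sets angle_measure = sets (restrict_space borel {-pi<..pi})"
  unfolding angle_measure_def by (rule sets_restrict_space_cong) simp

lemma emeasure_angle_measure:
  "A \<in> sets borel \<Longrightarrow> A \<subseteq> {-pi<..pi} \<Longrightarrow> emeasure angle_measure A = emeasure lborel A"
  by (simp add: angle_measure_def emeasure_restrict_space)

lemma in_sets_angle_measure: "A \<in> sets borel \<Longrightarrow> A \<subseteq> {-pi<..pi} \<Longrightarrow> A \<in> sets angle_measure"
  by (auto simp: sets_angle_measure sets_restrict_space_iff)

lemma emeasure_angle_measure_space [simp]: "emeasure angle_measure {-pi<..pi} = ennreal (2 * pi)"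
  by (simp add: emeasure_angle_measure)

lemma measurable_angle_measure:
  "f \<in> borel_measurable borel \<Longrightarrow> f \<in> borel_measurable angle_measure"
  by (simp add: angle_measure_def measurable_restrict_space1)

lemma finite_measure_angle_measure: "finite_measure angle_measure"
  by (intro finite_measureI) simp

interpretation angle: product_sigma_finite "\<lambda>_ :: nat. angle_measure"
  using finite_measure_angle_measure
  by (intro product_sigma_finite.intro finite_measure.axioms)

section \<open>Integrating out one angle\<close>

text \<open>The left integrand is at most P U on a space of mass 2\<pi>; the right one is at least P
  V on a set of mass at least 1/(2n). The quotient is 4 \<pi> n U / V, with the scale P cancelled.
  Comparing two unnormalised integrals avoids dividing by the conditional normalisation.\<close>

lemma nn_integral_slice_le:
  fixes x :: "'a \<Rightarrow> real" and \<beta> L M \<delta> s :: real and J :: "'a set"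
  assumes "\<beta> \<ge> 0" and J: "finite J" "card J + 1 = n" and "n \<ge> 2"
    and s: "s = 1 \<or> s = - 1"
    and L: "\<bar>\<Sum>k\<in>J. cos (x k)\<bar> \<le> L" and M: "s * (\<Sum>k\<in>J. sin (x k)) \<ge> n - M"
    and params: "1 \<le> M" "M \<le> n" "L \<le> n" "L \<le> n * \<delta> / 16" "M \<le> n * \<delta>\<^sup>2 / 16" "\<delta> > 0"
  shows "(\<integral>\<^sup>+y. ennreal (\<Prod>k\<in>J. cmod (cis y - cis (- x k)) powr \<beta>) * 
      indicator {y. cmod (cis y - complex_of_real s * \<i>) > \<delta>} y \<partial>angle_measure)
    \<le> ennreal (4 * pi * n * exp (\<beta> * ln (1024 * real n ^ 4) * (M + 1) / 2 - \<beta> * n * \<delta>\<^sup>2 / 32))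
      * (\<integral>\<^sup>+y. ennreal (\<Prod>k\<in>J. cmod (cis y - cis (- x k)) powr \<beta>) \<partial>angle_measure)"
proof -
  define f where "f y = (\<Prod>k\<in>J. cmod (cis y - cis (- x k)) powr \<beta>)" for y
  define P where "P = (\<Prod>k\<in>J. 2 powr \<beta>)"
  define U where "U = exp (- \<beta> * n * \<delta>\<^sup>2 / 32)"
  define \<rho> where "\<rho> = 1 / (16 * (real n)\<^sup>2)"
  define V where "V = exp (- \<beta> * ln (4 / \<rho>\<^sup>2) * (M + 1) / 2)"
  define G where "G = {y \<in> {s * pi / 2..s * pi / 2 + 1 / n}. \<forall>k\<in>J. \<rho> \<le> cmod (cis y - cis (- x k))}"
  have P: "0 \<le> P" unfolding P_def by (intro prod_nonneg) auto
  have "(\<integral>\<^sup>+y. ennreal (f y) * indicator {y. cmod (cis y - complex_of_real s * \<i>) > \<delta>} y \<partial>angle_measure)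
    \<le> (\<integral>\<^sup>+y. ennreal (P * U) \<partial>angle_measure)"
  proof (intro nn_integral_mono)
    fix y
    have "f y \<le> P * U" if "cmod (cis y - complex_of_real s * \<i>) > \<delta>"
      unfolding f_def P_def U_def
      by (rule mirror_slice_le[OF assms(1-7) params(1,2,4-6) that])
    then show "ennreal (f y) * indicator {y. cmod (cis y - complex_of_real s * \<i>) > \<delta>} y
        \<le> ennreal (P * U)"
      by (auto simp: indicator_def intro: ennreal_leI)
  qed
  also have "\<dots> = ennreal (P * U * (2 * pi))"
    using P by (simp add: ennreal_mult U_def)
  also have "\<dots> = ennreal (4 * pi * n * (U / V)) * ennreal (P * V * (1 / (2 * real n)))"
  proof -
    have "U > 0" "V > 0" by (simp_all add: U_def V_def)
    moreover from this have "P * U * (2 * pi) = (4 * pi * n * (U / V)) * (P * V * (1 / (2 * real n)))"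
      using \<open>n \<ge> 2\<close> by simp
    ultimately show ?thesis using P by (simp only: ) (intro ennreal_mult, auto)
  qed
  also have "\<dots> \<le> ennreal (4 * pi * n * (U / V)) * (\<integral>\<^sup>+y. ennreal (f y) \<partial>angle_measure)"
  proof (intro mult_left_mono)
    have "G \<in> sets borel" unfolding G_def by (rule borel_cis_far_interval)
    \<comment> \<open>An interval of length at most 1 starting at \<open>s * pi / 2\<close> stays
      inside (-\<pi>, \<pi>], so no wrap-around occurs.\<close>
    moreover have "1 / n \<le> (1 :: real)" using \<open>n \<ge> 2\<close> by simp
    then have "G \<subseteq> {-pi<..pi}"
      using s pi_gt3 by (auto simp: G_def)
    ultimately have G: "G \<in> sets angle_measure" "emeasure angle_measure G = emeasure lborel G"
      by (auto simp: in_sets_angle_measure emeasure_angle_measure)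
    have "ennreal (P * V * (1 / (2 * real n))) = ennreal (P * V) * ennreal (1 / (2 * real n))"
      using P by (intro ennreal_mult) (auto simp: V_def)
    also have "\<dots> \<le> ennreal (P * V) * emeasure angle_measure G"
      unfolding G(2) unfolding G_def \<rho>_def using J \<open>n \<ge> 2\<close>
      by (intro mult_left_mono emeasure_cis_far_ge) auto
    also have "\<dots> = (\<integral>\<^sup>+y. ennreal (P * V) * indicator G y \<partial>angle_measure)"
      using G by (simp add: nn_integral_cmult_indicator)
    also have "\<dots> \<le> (\<integral>\<^sup>+y. ennreal (f y) \<partial>angle_measure)"
    proof (intro nn_integral_mono)
      fix y
      have "P * V \<le> f y" if "y \<in> G"
        unfolding P_def V_def f_def
      proof (rule mirror_slice_ge[OF assms(1-7) params(2,3)])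
        show "0 < \<rho>" using \<open>n \<ge> 2\<close> by (simp add: \<rho>_def)
        have "1 \<le> (real n)\<^sup>2" using \<open>n \<ge> 2\<close> by (intro one_le_power) auto
        then have "1 \<le> 16 * (real n)\<^sup>2" by linarith
        then show "\<rho> \<le> 1" unfolding \<rho>_def using \<open>n \<ge> 2\<close> by (subst divide_le_eq_1_pos) auto
      qed (use that in \<open>auto simp: G_def\<close>)
      then show "ennreal (P * V) * indicator G y \<le> ennreal (f y)"
        by (auto simp: indicator_def intro: ennreal_leI)
    qed
    finally show "ennreal (P * V * (1 / (2 * real n))) \<le> (\<integral>\<^sup>+y. ennreal (f y) \<partial>angle_measure)" .
  qed simp
  also have "4 / \<rho>\<^sup>2 = 1024 * real n ^ 4" by (simp add: \<rho>_def power_divide power_mult_distrib)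
  then have "U / V = exp (\<beta> * ln (1024 * real n ^ 4) * (M + 1) / 2 - \<beta> * n * \<delta>\<^sup>2 / 32)"
    by (simp add: U_def V_def flip: exp_diff)
  finally show ?thesis unfolding f_def .
qed

lemma borel_measurable_cis [measurable]: "cis \<in> borel_measurable borel"
  by (intro borel_measurable_continuous_onI continuous_intros)

lemma measurable_angle_component:
  assumes "j \<in> I"
  shows "(\<lambda>\<theta>. \<theta> j) \<in> borel_measurable (\<Pi>\<^sub>M j\<in>I. angle_measure)"
proof -
  have "(\<lambda>\<theta>. \<theta> j) \<in> measurable (\<Pi>\<^sub>M j\<in>I. angle_measure) angle_measure"
    using assms by (rule measurable_component_singleton)
  moreover have "(\<lambda>x. x) \<in> borel_measurable angle_measure"
    by (rule measurable_angle_measure) simp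
  ultimately show ?thesis by (rule measurable_compose)
qed

lemma mirror_weight_measurable [measurable]:
  "mirror_weight \<beta> n \<in> borel_measurable (angle_lborel n)"
  unfolding mirror_weight_def[abs_def] angle_lborel_eq
proof (intro borel_measurable_prod)
  fix j k assume "j \<in> {1..n}" "k \<in> {j<..n}"
  then have [measurable]: "(\<lambda>\<theta>. \<theta> j) \<in> borel_measurable (\<Pi>\<^sub>M j\<in>{1..n}. angle_measure)"
      "(\<lambda>\<theta>. \<theta> k) \<in> borel_measurable (\<Pi>\<^sub>M j\<in>{1..n}. angle_measure)"
    by (auto intro: measurable_angle_component)
  show "(\<lambda>\<theta>. cmod (cis (\<theta> j) - cis (- \<theta> k)) powr \<beta>) \<in> borel_measurable (\<Pi>\<^sub>M j\<in>{1..n}. angle_measure)"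
    by measurable
qed

text \<open>Fubini with the i-th angle innermost. The sums in the event leave out \<open>i\<close>,
  so the event splits into a condition \<open>H\<close> on the other angles and the condition
  \<open>far\<close> on this one; the weight splits likewise into \<open>R x\<close> and
  \<open>f x y\<close>. The slice estimate is then applied for each fixed x.\<close>

lemma nn_integral_bad_coordinate_le:
  fixes \<beta> L M \<delta> s :: real and i n :: nat
  assumes "\<beta> \<ge> 0" and i: "i \<in> {1..n}" and "n \<ge> 2"
    and s: "s = 1 \<or> s = - 1"
    and params: "1 \<le> M" "M \<le> n" "L \<le> n" "L \<le> n * \<delta> / 16" "M \<le> n * \<delta>\<^sup>2 / 16" "\<delta> > 0"
  shows "(\<integral>\<^sup>+\<theta>. ennreal (mirror_weight \<beta> n \<theta>) * indicator {\<theta>. \<bar>\<Sum>k\<in>{1..n} - {i}. cos (\<theta> k)\<bar> \<le> L \<and>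
        s * (\<Sum>k\<in>{1..n} - {i}. sin (\<theta> k)) \<ge> n - M \<and>
        cmod (cis (\<theta> i) - complex_of_real s * \<i>) > \<delta>} \<theta> \<partial>angle_lborel n)
    \<le> ennreal (4 * pi * n * exp (\<beta> * ln (1024 * real n ^ 4) * (M + 1) / 2 - \<beta> * n * \<delta>\<^sup>2 / 32))
      * (\<integral>\<^sup>+\<theta>. ennreal (mirror_weight \<beta> n \<theta>) \<partial>angle_lborel n)"
proof -
  define B where "B = {\<theta>. \<bar>\<Sum>k\<in>{1..n} - {i}. cos (\<theta> k)\<bar> \<le> L \<and>
        s * (\<Sum>k\<in>{1..n} - {i}. sin (\<theta> k)) \<ge> n - M \<and>
        cmod (cis (\<theta> i) - complex_of_real s * \<i>) > \<delta>}"
  let ?J = "{1..n} - {i}"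
  let ?g = "\<lambda>x y. cmod (cis x - cis (- y)) powr \<beta>"
  let ?\<eta> = "ennreal (4 * pi * n * exp (\<beta> * ln (1024 * real n ^ 4) * (M + 1) / 2 - \<beta> * n * \<delta>\<^sup>2 / 32))"
  define f where "f x y = (\<Prod>k\<in>?J. ?g y (x k))" for x :: "nat \<Rightarrow> real" and y
  define R where "R x = (\<Prod>j\<in>?J. \<Prod>k\<in>{j<..n} - {i}. ?g (x j) (x k))" for x :: "nat \<Rightarrow> real"
  define H where "H = {x. \<bar>\<Sum>k\<in>?J. cos (x k)\<bar> \<le> L \<and> s * (\<Sum>k\<in>?J. sin (x k)) \<ge> n - M}"
  define far where "far = {y. cmod (cis y - complex_of_real s * \<i>) > \<delta>}"
  have I: "insert i ?J = {1..n}" using i by auto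
  have sym: "?g x y = ?g y x" for x y
    using mirror_factor_eq[of x y \<beta>] mirror_factor_eq[of y x \<beta>]
    by (simp add: pair_defect_def add.commute)
  have R: "R x \<ge> 0" and f: "f x y \<ge> 0" for x y unfolding R_def f_def by (auto intro!: prod_nonneg)
  have W: "mirror_weight \<beta> n (x(i := y)) = R x * f x y" for x y
  proof -
    have "mirror_weight \<beta> n (x(i := y)) = f (x(i := y)) y * R (x(i := y))"
      unfolding mirror_weight_def f_def R_def
      using prod_ordered_pairs_split[OF i, of "\<lambda>j k. ?g ((x(i := y)) j) ((x(i := y)) k)", OF sym]
      by simp
    also have "f (x(i := y)) y = f x y" unfolding f_def by (intro prod.cong) auto
    also have "R (x(i := y)) = R x" unfolding R_def by (intro prod.cong) auto
    finally show ?thesis by (simp only: mult.commute)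
  qed
  have "(\<Sum>k\<in>?J. cos ((x(i := y)) k)) = (\<Sum>k\<in>?J. cos (x k))"
    "(\<Sum>k\<in>?J. sin ((x(i := y)) k)) = (\<Sum>k\<in>?J. sin (x k))" for x :: "nat \<Rightarrow> real" and y
    by (auto intro!: sum.cong)
  then have indB: "indicator B (x(i := y)) = (indicator H x * indicator far y :: ennreal)" for x y
    by (auto simp: B_def H_def far_def indicator_def)
  have fm [measurable]: "f x \<in> borel_measurable angle_measure" for x
    unfolding f_def[abs_def] by (intro borel_measurable_prod measurable_angle_measure) measurable
  have "far \<in> sets borel"
    unfolding far_def by measurable
  then have far_m: "(\<lambda>y. indicator far y :: ennreal) \<in> borel_measurable angle_measure"
    by (intro measurable_angle_measure borel_measurable_indicator)
  have Wm: "(\<lambda>\<theta>. ennreal (mirror_weight \<beta> n \<theta>)) \<in> borel_measurable (angle_lborel n)"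
    by (rule measurable_compose[OF mirror_weight_measurable measurable_ennreal])
  have Bm: "(\<lambda>\<theta>. indicator B \<theta> :: ennreal) \<in> borel_measurable (angle_lborel n)"
  proof -
    have [measurable]: "(\<lambda>\<theta>. \<theta> i) \<in> borel_measurable (\<Pi>\<^sub>M j\<in>{1..n}. angle_measure)"
      using i by (rule measurable_angle_component)
    have [measurable]: "(\<lambda>\<theta>. \<Sum>k\<in>?J. cos (\<theta> k)) \<in> borel_measurable (\<Pi>\<^sub>M j\<in>{1..n}. angle_measure)"
      "(\<lambda>\<theta>. \<Sum>k\<in>?J. sin (\<theta> k)) \<in> borel_measurable (\<Pi>\<^sub>M j\<in>{1..n}. angle_measure)"
      by (auto intro!: borel_measurable_sum measurable_compose[OF measurable_angle_component borel_measurable_cos]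
          measurable_compose[OF measurable_angle_component borel_measurable_sin])
    show ?thesis unfolding angle_lborel_eq B_def by measurable
  qed
  have fubini: "(\<integral>\<^sup>+\<theta>. F \<theta> \<partial>angle_lborel n)
    = (\<integral>\<^sup>+x. \<integral>\<^sup>+y. F (x(i := y)) \<partial>angle_measure \<partial>(\<Pi>\<^sub>M j\<in>?J. angle_measure))"
    if "F \<in> borel_measurable (angle_lborel n)" for F
    using angle.product_nn_integral_insert[of ?J i F] that unfolding I angle_lborel_eq by simp
  have "(\<integral>\<^sup>+\<theta>. ennreal (mirror_weight \<beta> n \<theta>) * indicator B \<theta> \<partial>angle_lborel n)
    = (\<integral>\<^sup>+x. \<integral>\<^sup>+y. ennreal (mirror_weight \<beta> n (x(i := y))) * indicator B (x(i := y)) \<partial>angle_measure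
        \<partial>(\<Pi>\<^sub>M j\<in>?J. angle_measure))"
    by (intro fubini borel_measurable_times_ennreal Wm Bm)
  also have "\<dots> \<le> (\<integral>\<^sup>+x. \<integral>\<^sup>+y. ?\<eta> * ennreal (mirror_weight \<beta> n (x(i := y))) \<partial>angle_measure
        \<partial>(\<Pi>\<^sub>M j\<in>?J. angle_measure))"
  proof (rule nn_integral_mono)
    fix x :: "nat \<Rightarrow> real"
    have "(\<integral>\<^sup>+y. ennreal (mirror_weight \<beta> n (x(i := y))) * indicator B (x(i := y)) \<partial>angle_measure)
      = (\<integral>\<^sup>+y. (ennreal (R x) * indicator H x) * (ennreal (f x y) * indicator far y) \<partial>angle_measure)"
      unfolding W indB using R f by (simp add: ennreal_mult mult_ac)
    also have "\<dots> = (ennreal (R x) * indicator H x) * (\<integral>\<^sup>+y. ennreal (f x y) * indicator far y \<partial>angle_measure)"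
      by (intro nn_integral_cmult borel_measurable_times_ennreal far_m) measurable
    \<comment> \<open>Outside \<open>H\<close> the left side is 0, so the indicator of
      \<open>H\<close> may be dropped on the right.\<close>
    also have "\<dots> \<le> ennreal (R x) * (?\<eta> * (\<integral>\<^sup>+y. ennreal (f x y) \<partial>angle_measure))"
    proof (cases "x \<in> H")
      case True
      have "(\<integral>\<^sup>+y. ennreal (f x y) * indicator far y \<partial>angle_measure)
          \<le> ?\<eta> * (\<integral>\<^sup>+y. ennreal (f x y) \<partial>angle_measure)"
        unfolding f_def far_def
        using True i by (intro nn_integral_slice_le[OF assms(1) _ _ assms(3,4) _ _ params]) (auto simp: H_def)
      then show ?thesis using True by (simp add: mult_left_mono)
    qed simp
    also have "\<dots> = ?\<eta> * (ennreal (R x) * (\<integral>\<^sup>+y. ennreal (f x y) \<partial>angle_measure))"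
      by (simp add: mult_ac)
    also have "\<dots> = (\<integral>\<^sup>+y. ?\<eta> * ennreal (mirror_weight \<beta> n (x(i := y))) \<partial>angle_measure)"
      unfolding W using R f by (simp add: ennreal_mult nn_integral_cmult)
    finally show "(\<integral>\<^sup>+y. ennreal (mirror_weight \<beta> n (x(i := y))) * indicator B (x(i := y)) \<partial>angle_measure)
      \<le> (\<integral>\<^sup>+y. ?\<eta> * ennreal (mirror_weight \<beta> n (x(i := y))) \<partial>angle_measure)" .
  qed
  also have "\<dots> = (\<integral>\<^sup>+\<theta>. ?\<eta> * ennreal (mirror_weight \<beta> n \<theta>) \<partial>angle_lborel n)"
    by (intro fubini[symmetric] borel_measurable_times_ennreal Wm borel_measurable_const)
  also have "\<dots> = ?\<eta> * (\<integral>\<^sup>+\<theta>. ennreal (mirror_weight \<beta> n \<theta>) \<partial>angle_lborel n)"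
    by (intro nn_integral_cmult) measurable
  finally show ?thesis unfolding B_def .
qed

section \<open>Normalising constant and probabilities\<close>

lemma emeasure_space_angle_lborel: "emeasure (angle_lborel n) (space (angle_lborel n)) = ennreal ((2 * pi) ^ n)"
proof -
  have "emeasure (angle_lborel n) (space (angle_lborel n))
      = (\<Prod>j\<in>{1..n}. emeasure angle_measure (space angle_measure))"
    unfolding angle_lborel_eq space_PiM by (rule angle.emeasure_PiM) (auto simp del: space_angle_measure)
  then show ?thesis by (simp add: ennreal_power)
qed

lemma finite_measure_angle_lborel: "finite_measure (angle_lborel n)"
  by (intro finite_measureI) (simp add: emeasure_space_angle_lborel)

lemma integrable_mirror_weight:
  assumes "\<beta> \<ge> 0"
  shows "integrable (angle_lborel n) (mirror_weight \<beta> n)"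
  by (rule finite_measure.integrable_const_bound[OF finite_measure_angle_lborel, where B = "mirror_max \<beta> n"])
    (use assms in \<open>auto simp: mirror_weight_nonneg mirror_weight_le_max\<close>)

lemma nn_integral_mirror_weight:
  assumes "\<beta> \<ge> 0"
  shows "(\<integral>\<^sup>+\<theta>. ennreal (mirror_weight \<beta> n \<theta>) \<partial>angle_lborel n) = ennreal (mirror_Z \<beta> n)"
  unfolding mirror_Z_def
  using assms by (intro nn_integral_eq_integral integrable_mirror_weight) (auto simp: mirror_weight_nonneg)

text \<open>Only the cube of side 1/n with corner at the maximiser is kept. Its volume costs n^n =
  exp (n log n), which the spread bound can afford once K grows like a power of n.\<close>

lemma mirror_Z_ge:
  assumes "\<beta> \<ge> 0" "n \<ge> 2"
  shows "mirror_max \<beta> n * exp (- 2 * \<beta>) * (1 / n) ^ n \<le> mirror_Z \<beta> n"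
proof -
  let ?I = "{pi / 2..pi / 2 + 1 / n}"
  have "1 / n \<le> (1 :: real)" using assms by simp
  then have I: "?I \<subseteq> {-pi<..pi}" using pi_gt3 by auto
  have "ennreal (mirror_max \<beta> n * exp (- 2 * \<beta>) * (1 / n) ^ n)
      = ennreal (mirror_max \<beta> n * exp (- 2 * \<beta>)) * (\<Prod>j\<in>{1..n}. emeasure angle_measure ?I)"
    using mirror_max_pos[of \<beta> n] I
    by (simp add: emeasure_angle_measure ennreal_mult ennreal_power)
  also have "(\<Prod>j\<in>{1..n}. emeasure angle_measure ?I) = emeasure (angle_lborel n) (\<Pi>\<^sub>E j\<in>{1..n}. ?I)"
    unfolding angle_lborel_eq using I
    by (intro angle.emeasure_PiM[symmetric] in_sets_angle_measure) auto
  also have "ennreal (mirror_max \<beta> n * exp (- 2 * \<beta>)) * \<dots>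
      = (\<integral>\<^sup>+\<theta>. ennreal (mirror_max \<beta> n * exp (- 2 * \<beta>)) * indicator (\<Pi>\<^sub>E j\<in>{1..n}. ?I) \<theta> \<partial>angle_lborel n)"
    unfolding angle_lborel_eq using I
    by (intro nn_integral_cmult_indicator[symmetric] sets_PiM_I_finite in_sets_angle_measure) auto
  also have "\<dots> \<le> (\<integral>\<^sup>+\<theta>. ennreal (mirror_weight \<beta> n \<theta>) \<partial>angle_lborel n)"
  proof (intro nn_integral_mono)
    fix \<theta> :: "nat \<Rightarrow> real"
    have "mirror_max \<beta> n * exp (- 2 * \<beta>) \<le> mirror_weight \<beta> n \<theta>" if "\<theta> \<in> (\<Pi>\<^sub>E j\<in>{1..n}. ?I)"
      using that by (intro mirror_weight_ge_box assms) (rule PiE_mem)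
    then show "ennreal (mirror_max \<beta> n * exp (- 2 * \<beta>)) * indicator (\<Pi>\<^sub>E j\<in>{1..n}. ?I) \<theta>
        \<le> ennreal (mirror_weight \<beta> n \<theta>)"
      by (auto simp: indicator_def simp del: PiE_iff intro: ennreal_leI)
  qed
  also have "\<dots> = ennreal (mirror_Z \<beta> n)"
    using assms(1) by (rule nn_integral_mirror_weight)
  finally show ?thesis
    by (subst (asm) ennreal_le_iff)
      (simp_all add: mirror_Z_def Bochner_Integration.integral_nonneg mirror_weight_nonneg)
qed

lemma mirror_Z_pos: "\<beta> \<ge> 0 \<Longrightarrow> n \<ge> 2 \<Longrightarrow> 0 < mirror_Z \<beta> n"
  by (rule less_le_trans[OF _ mirror_Z_ge]) (auto simp: mirror_max_pos)

text \<open>The pointwise bound on the event, multiplied by the full volume (2\<pi>)^n, is rewritten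
  as a multiple of the lower bound in \<open>mirror_Z_ge\<close>.\<close>

lemma nn_integral_spread_le:
  fixes K :: real
  assumes "\<beta> \<ge> 0" "K \<ge> 4" "n \<ge> 2"
  shows "(\<integral>\<^sup>+\<theta>. ennreal (mirror_weight \<beta> n \<theta>) * indicator {\<theta>. (real n)\<^sup>2 - (\<Sum>j\<in>{1..n}. sin (\<theta> j))\<^sup>2
        + (\<Sum>j\<in>{1..n}. cos (\<theta> j))\<^sup>2 > K * n} \<theta> \<partial>angle_lborel n)
    \<le> ennreal ((2 * pi * n) ^ n * exp (2 * \<beta> - \<beta> * K * n / 16)) * ennreal (mirror_Z \<beta> n)"
proof -
  define B where "B = {\<theta>. (real n)\<^sup>2 - (\<Sum>j\<in>{1..n}. sin (\<theta> j))\<^sup>2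
        + (\<Sum>j\<in>{1..n}. cos (\<theta> j))\<^sup>2 > K * n}"
  have "(\<integral>\<^sup>+\<theta>. ennreal (mirror_weight \<beta> n \<theta>) * indicator B \<theta> \<partial>angle_lborel n)
      \<le> (\<integral>\<^sup>+\<theta>. ennreal (mirror_max \<beta> n * exp (- \<beta> * K * n / 16)) \<partial>angle_lborel n)"
    using mirror_weight_le_spread[OF assms(1,2)]
    by (intro nn_integral_mono) (auto simp: B_def indicator_def intro!: ennreal_leI)
  also have "\<dots> = ennreal (mirror_max \<beta> n * exp (- \<beta> * K * n / 16) * (2 * pi) ^ n)"
    using mirror_max_pos[of \<beta> n] by (simp add: emeasure_space_angle_lborel ennreal_mult)
  also have "mirror_max \<beta> n * exp (- \<beta> * K * n / 16) * (2 * pi) ^ n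
      = ((2 * pi * n) ^ n * exp (2 * \<beta> - \<beta> * K * n / 16))
        * (mirror_max \<beta> n * exp (- 2 * \<beta>) * (1 / n) ^ n)"
  proof -
    have "(2 * pi * n) ^ n * (1 / n) ^ n = (2 * pi) ^ n"
      using assms(3) by (subst power_mult_distrib[symmetric]) simp
    moreover have "exp (2 * \<beta> - \<beta> * K * n / 16) * exp (- 2 * \<beta>) = exp (- \<beta> * K * n / 16)"
      by (subst exp_add[symmetric]) simp
    moreover have "m * e2 * p2 = (p * e) * (m * e1 * p1)" if "p * p1 = p2" "e * e1 = e2"
      for m e e1 e2 p p1 p2 :: real
      unfolding that[symmetric] by (simp add: mult_ac)
    ultimately show ?thesis by blast
  qed
  also have "ennreal \<dots> \<le> ennreal (((2 * pi * n) ^ n * exp (2 * \<beta> - \<beta> * K * n / 16)) * mirror_Z \<beta> n)"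
    using assms by (intro ennreal_leI mult_left_mono mirror_Z_ge) auto
  also have "\<dots> = ennreal ((2 * pi * n) ^ n * exp (2 * \<beta> - \<beta> * K * n / 16)) * ennreal (mirror_Z \<beta> n)"
    using mirror_Z_pos[OF assms(1,3)] by (intro ennreal_mult) auto
  finally show ?thesis unfolding B_def .
qed

lemma emeasure_mirror_process:
  assumes "\<beta> \<ge> 0" "n \<ge> 2" "B \<in> sets (angle_lborel n)"
  shows "emeasure (mirror_process \<beta> n) B = ennreal (1 / mirror_Z \<beta> n) *
    (\<integral>\<^sup>+\<theta>. ennreal (mirror_weight \<beta> n \<theta>) * indicator B \<theta> \<partial>angle_lborel n)"
proof -
  note [measurable] = assms(3)
  have "emeasure (mirror_process \<beta> n) B =
      (\<integral>\<^sup>+\<theta>. ennreal (1 / mirror_Z \<beta> n * mirror_weight \<beta> n \<theta>) * indicator B \<theta> \<partial>angle_lborel n)"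
    unfolding mirror_process_def by (intro emeasure_density) measurable
  also have "\<dots> = (\<integral>\<^sup>+\<theta>. ennreal (1 / mirror_Z \<beta> n) *
      (ennreal (mirror_weight \<beta> n \<theta>) * indicator B \<theta>) \<partial>angle_lborel n)"
    using mirror_Z_pos[OF assms(1,2)]
    by (subst ennreal_mult) (simp_all add: mirror_weight_nonneg mult.assoc)
  also have "\<dots> = ennreal (1 / mirror_Z \<beta> n) *
    (\<integral>\<^sup>+\<theta>. ennreal (mirror_weight \<beta> n \<theta>) * indicator B \<theta> \<partial>angle_lborel n)"
    by (intro nn_integral_cmult) measurable
  finally show ?thesis .
qed

lemma prob_space_mirror_process:
  assumes "\<beta> \<ge> 0" "n \<ge> 2"
  shows "prob_space (mirror_process \<beta> n)"
proof
  note Z = mirror_Z_pos[OF assms]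
  have "emeasure (mirror_process \<beta> n) (space (mirror_process \<beta> n))
      = ennreal (1 / mirror_Z \<beta> n) * (\<integral>\<^sup>+\<theta>. ennreal (mirror_weight \<beta> n \<theta>)
          * indicator (space (angle_lborel n)) \<theta> \<partial>angle_lborel n)"
    using emeasure_mirror_process[OF assms, of "space (angle_lborel n)"]
    by (simp add: mirror_process_def)
  also have "(\<integral>\<^sup>+\<theta>. ennreal (mirror_weight \<beta> n \<theta>) * indicator (space (angle_lborel n)) \<theta> \<partial>angle_lborel n)
      = (\<integral>\<^sup>+\<theta>. ennreal (mirror_weight \<beta> n \<theta>) \<partial>angle_lborel n)"
    by (intro nn_integral_cong) simp
  also have "\<dots> = ennreal (mirror_Z \<beta> n)" by (rule nn_integral_mirror_weight[OF assms(1)])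
  also have "ennreal (1 / mirror_Z \<beta> n) * ennreal (mirror_Z \<beta> n) = 1" using Z by (subst ennreal_mult[symmetric]) auto
  finally show "emeasure (mirror_process \<beta> n) (space (mirror_process \<beta> n)) = 1" .
qed

text \<open>Passes from unnormalised integrals to probabilities. \<open>B\<close> need not lie in
  the space, so that the integral estimates can be stated with plain comprehensions; the indicators
  agree where the measure lives.\<close>

lemma measure_mirror_process_le:
  assumes "\<beta> \<ge> 0" "n \<ge> 2" "\<eta> \<ge> 0" and B: "{\<theta> \<in> space (angle_lborel n). \<theta> \<in> B} \<in> sets (angle_lborel n)"
    and int: "(\<integral>\<^sup>+\<theta>. ennreal (mirror_weight \<beta> n \<theta>) * indicator B \<theta> \<partial>angle_lborel n)
      \<le> ennreal \<eta> * ennreal (mirror_Z \<beta> n)"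
  shows "measure (mirror_process \<beta> n) {\<theta> \<in> space (angle_lborel n). \<theta> \<in> B} \<le> \<eta>"
proof -
  let ?B = "{\<theta> \<in> space (angle_lborel n). \<theta> \<in> B}"
  note Z = mirror_Z_pos[OF assms(1,2)]
  interpret prob_space "mirror_process \<beta> n"
    using assms by (intro prob_space_mirror_process)
  have "emeasure (mirror_process \<beta> n) ?B = ennreal (1 / mirror_Z \<beta> n) *
      (\<integral>\<^sup>+\<theta>. ennreal (mirror_weight \<beta> n \<theta>) * indicator ?B \<theta> \<partial>angle_lborel n)"
    by (rule emeasure_mirror_process[OF assms(1,2) B])
  also have "(\<integral>\<^sup>+\<theta>. ennreal (mirror_weight \<beta> n \<theta>) * indicator ?B \<theta> \<partial>angle_lborel n)
      = (\<integral>\<^sup>+\<theta>. ennreal (mirror_weight \<beta> n \<theta>) * indicator B \<theta> \<partial>angle_lborel n)"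
    by (intro nn_integral_cong) (simp add: indicator_def)
  also have "ennreal (1 / mirror_Z \<beta> n) * \<dots>
      \<le> ennreal (1 / mirror_Z \<beta> n) * (ennreal \<eta> * ennreal (mirror_Z \<beta> n))"
    using int by (intro mult_left_mono) auto
  also have "\<dots> = ennreal (1 / mirror_Z \<beta> n * (\<eta> * mirror_Z \<beta> n))"
    using Z assms(3) by (subst ennreal_mult, simp, simp, subst ennreal_mult, simp_all)
  also have "1 / mirror_Z \<beta> n * (\<eta> * mirror_Z \<beta> n) = \<eta>" using Z by simp
  finally show ?thesis
    using assms(3) by (simp add: emeasure_eq_measure)
qed

section \<open>Union bound over bad events\<close>

text \<open>As |Y| \<le> n, both n^2 - Y^2 and X^2 are nonnegative, so each is at most K n.
  Factoring the first as (n - |Y|)(n + |Y|) with second factor at least n gives n - |Y| \<le> K, and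
  \<open>s\<close> is the sign of Y. Deleting one index changes either sum by at most 1, hence the
  added ones.\<close>

lemma concentrated_sums:
  fixes K :: real and \<theta> :: "nat \<Rightarrow> real"
  assumes "n > 0"
    and D: "(real n)\<^sup>2 - (\<Sum>j\<in>{1..n}. sin (\<theta> j))\<^sup>2 + (\<Sum>j\<in>{1..n}. cos (\<theta> j))\<^sup>2 \<le> K * n"
  obtains s :: real where "s = 1 \<or> s = - 1"
    "\<And>i. i \<in> {1..n} \<Longrightarrow> \<bar>\<Sum>k\<in>{1..n} - {i}. cos (\<theta> k)\<bar> \<le> sqrt (K * n) + 1"
    "\<And>i. i \<in> {1..n} \<Longrightarrow> s * (\<Sum>k\<in>{1..n} - {i}. sin (\<theta> k)) \<ge> n - (K + 1)"
proof
  define X Y where "X = (\<Sum>j\<in>{1..n}. cos (\<theta> j))" and "Y = (\<Sum>j\<in>{1..n}. sin (\<theta> j))"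
  define s :: real where "s = (if Y \<ge> 0 then 1 else - 1)"
  show "s = 1 \<or> s = - 1" by (simp add: s_def)
  have "\<bar>Y\<bar> \<le> (\<Sum>j\<in>{1..n}. 1)" unfolding Y_def by (intro order.trans[OF sum_abs] sum_mono) auto
  then have Y: "\<bar>Y\<bar> \<le> n" by simp
  then have "Y\<^sup>2 \<le> (real n)\<^sup>2" using abs_le_square_iff[of Y "real n"] by simp
  then have "X\<^sup>2 \<le> K * n" using D by (simp add: X_def Y_def)
  then have X: "\<bar>X\<bar> \<le> sqrt (K * n)" using real_le_rsqrt[of "\<bar>X\<bar>"] by simp
  have "(n - \<bar>Y\<bar>) * n \<le> (n - \<bar>Y\<bar>) * (n + \<bar>Y\<bar>)" using Y by (intro mult_left_mono) auto
  also have "\<dots> = (real n)\<^sup>2 - Y\<^sup>2" by (simp add: power2_eq_square algebra_simps)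
  also have "\<dots> \<le> (real n)\<^sup>2 - Y\<^sup>2 + X\<^sup>2" by simp
  also have "\<dots> \<le> K * n" using D by (simp add: X_def Y_def)
  finally have "n - \<bar>Y\<bar> \<le> K" using \<open>n > 0\<close> by simp
  moreover have "\<bar>Y\<bar> = s * Y" by (simp add: s_def)
  ultimately have sY: "n - K \<le> s * Y" by simp
  fix i assume i: "i \<in> {1..n}"
  have "X = cos (\<theta> i) + (\<Sum>k\<in>{1..n} - {i}. cos (\<theta> k))"
    unfolding X_def using i by (intro sum.remove) auto
  moreover have "\<bar>cos (\<theta> i)\<bar> \<le> 1" by simp
  ultimately show "\<bar>\<Sum>k\<in>{1..n} - {i}. cos (\<theta> k)\<bar> \<le> sqrt (K * n) + 1" using X by linarith
  have "Y = sin (\<theta> i) + (\<Sum>k\<in>{1..n} - {i}. sin (\<theta> k))"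
    unfolding Y_def using i by (intro sum.remove) auto
  then have "s * Y = s * sin (\<theta> i) + s * (\<Sum>k\<in>{1..n} - {i}. sin (\<theta> k))"
    by (simp add: distrib_left)
  moreover have "s * sin (\<theta> i) \<le> 1" using sin_ge_minus_one[of "\<theta> i"] by (auto simp: s_def)
  ultimately show "s * (\<Sum>k\<in>{1..n} - {i}. sin (\<theta> k)) \<ge> n - (K + 1)" using sY by linarith
qed

lemma mirror_process_prob_ge:
  fixes \<beta> K \<delta> :: real and n :: nat
  assumes "\<beta> \<ge> 0" "n \<ge> 2" "K \<ge> 4" "\<delta> > 0"
    and params: "K + 1 \<le> n" "sqrt (K * n) + 1 \<le> n" "sqrt (K * n) + 1 \<le> n * \<delta> / 16"
      "K + 1 \<le> n * \<delta>\<^sup>2 / 16"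
  shows "measure (mirror_process \<beta> n)
      {\<theta> \<in> space (mirror_process \<beta> n).
         (\<forall>j\<in>{1..n}. cmod (cis (\<theta> j) - \<i>) \<le> \<delta>) \<or> (\<forall>j\<in>{1..n}. cmod (cis (\<theta> j) + \<i>) \<le> \<delta>)}
    \<ge> 1 - ((2 * pi * n) ^ n * exp (2 * \<beta> - \<beta> * K * n / 16) + 2 * n *
        (4 * pi * n * exp (\<beta> * ln (1024 * real n ^ 4) * (K + 1 + 1) / 2 - \<beta> * n * \<delta>\<^sup>2 / 32)))"
    (is "measure ?P ?E \<ge> 1 - (?\<zeta> + _ * ?\<eta>)")
proof -
  let ?M = "angle_lborel n"
  define B0 where "B0 = {\<theta> \<in> space ?M. \<theta> \<in> {\<theta>. (real n)\<^sup>2 - (\<Sum>j\<in>{1..n}. sin (\<theta> j))\<^sup>2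
        + (\<Sum>j\<in>{1..n}. cos (\<theta> j))\<^sup>2 > K * n}}"
  \<comment> \<open>The sign found by \<open>concentrated_sums\<close> depends on the configuration,
    so both signs enter the union bound, giving 2 n events.\<close>
  define B where "B = (\<lambda>(i, s :: real). {\<theta> \<in> space ?M. \<theta> \<in> {\<theta>.
        \<bar>\<Sum>k\<in>{1..n} - {i}. cos (\<theta> k)\<bar> \<le> sqrt (K * n) + 1 \<and>
        s * (\<Sum>k\<in>{1..n} - {i}. sin (\<theta> k)) \<ge> n - (K + 1) \<and>
        cmod (cis (\<theta> i) - complex_of_real s * \<i>) > \<delta>}})"
  define I where "I = {1..n} \<times> {1, - 1 :: real}"
  interpret prob_space ?P using assms by (intro prob_space_mirror_process)
  have sets: "sets ?P = sets ?M" "space ?P = space ?M" by (simp_all add: mirror_process_def)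
  have comp: "(\<lambda>\<theta>. \<theta> j) \<in> borel_measurable ?M" if "j \<in> {1..n}" for j
    unfolding angle_lborel_eq using that by (rule measurable_angle_component)
  have sums: "(\<lambda>\<theta>. \<Sum>k\<in>A. cos (\<theta> k)) \<in> borel_measurable ?M"
    "(\<lambda>\<theta>. \<Sum>k\<in>A. sin (\<theta> k)) \<in> borel_measurable ?M" if "A \<subseteq> {1..n}" for A
    using that by (auto intro!: borel_measurable_sum measurable_compose[OF comp borel_measurable_cos]
        measurable_compose[OF comp borel_measurable_sin])
  have B0: "B0 \<in> sets ?M"
  proof -
    note [measurable] = sums[OF order_refl]
    show ?thesis unfolding B0_def mem_Collect_eq by measurable
  qed
  have B: "B p \<in> sets ?M" if pI: "p \<in> I" for p
  proof -
    obtain i s where p: "p = (i, s)" "i \<in> {1..n}" using pI by (auto simp: I_def)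
    note [measurable] = comp[OF p(2)] sums[OF Diff_subset, of "{i}"]
    show ?thesis unfolding B_def p(1) prod.case mem_Collect_eq by measurable
  qed
  have E: "?E \<in> sets ?M"
  proof -
    have "{\<theta> \<in> space ?M. cmod (cis (\<theta> j) - w) \<le> \<delta>} \<in> sets ?M" if "j \<in> {1..n}" for j w
    proof -
      note [measurable] = comp[OF that]
      show ?thesis by measurable
    qed
    from this[of _ \<i>] this[of _ "- \<i>"] show ?thesis
      unfolding sets(2) using \<open>n \<ge> 2\<close> by (intro sets.sets_Collect_disj sets.sets_Collect_finite_All') auto
  qed
  have "measure ?P B0 \<le> ?\<zeta>"
    unfolding B0_def
    by (rule measure_mirror_process_le[OF assms(1,2) _ B0[unfolded B0_def]
          nn_integral_spread_le[OF assms(1,3,2)]]) simp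
  have "measure ?P (B p) \<le> ?\<eta>" if pI: "p \<in> I" for p
  proof -
    obtain i s where p: "p = (i, s)" "i \<in> {1..n}" "s = 1 \<or> s = - 1" using pI by (auto simp: I_def)
    \<comment> \<open>The coordinate bound is used with L = sqrt (K n) + 1 and M = K + 1; its M + 1
      is the \<open>K + 1 + 1\<close> in the exponent.\<close>
    have "(\<integral>\<^sup>+\<theta>. ennreal (mirror_weight \<beta> n \<theta>) * indicator {\<theta>.
        \<bar>\<Sum>k\<in>{1..n} - {i}. cos (\<theta> k)\<bar> \<le> sqrt (K * n) + 1 \<and>
        s * (\<Sum>k\<in>{1..n} - {i}. sin (\<theta> k)) \<ge> n - (K + 1) \<and>
        cmod (cis (\<theta> i) - complex_of_real s * \<i>) > \<delta>} \<theta> \<partial>?M)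
      \<le> ennreal ?\<eta> * ennreal (mirror_Z \<beta> n)"
      unfolding nn_integral_mirror_weight[OF assms(1), symmetric]
      using assms p by (intro nn_integral_bad_coordinate_le) auto
    then show ?thesis
      using B[OF pI] unfolding B_def p(1) prod.case
      by (intro measure_mirror_process_le assms) auto
  qed
  have "space ?P - ?E \<subseteq> B0 \<union> (\<Union>p\<in>I. B p)"
  proof
    fix \<theta> assume \<theta>: "\<theta> \<in> space ?P - ?E"
    show "\<theta> \<in> B0 \<union> (\<Union>p\<in>I. B p)"
    proof (cases "\<theta> \<in> B0")
      case False
      then have "(real n)\<^sup>2 - (\<Sum>j\<in>{1..n}. sin (\<theta> j))\<^sup>2 + (\<Sum>j\<in>{1..n}. cos (\<theta> j))\<^sup>2 \<le> K * n"
        using \<theta> by (simp add: B0_def sets)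
      from concentrated_sums[OF _ this] \<open>n \<ge> 2\<close> obtain s :: real where s: "s = 1 \<or> s = - 1"
        "\<And>i. i \<in> {1..n} \<Longrightarrow> \<bar>\<Sum>k\<in>{1..n} - {i}. cos (\<theta> k)\<bar> \<le> sqrt (K * n) + 1"
        "\<And>i. i \<in> {1..n} \<Longrightarrow> s * (\<Sum>k\<in>{1..n} - {i}. sin (\<theta> k)) \<ge> n - (K + 1)"
        by (metis gr0I not_numeral_le_zero)
      \<comment> \<open>Not all angles are within \<delta> of the pole \<open>s * \<i>\<close>,
        since that alone would place the configuration in the good event.\<close>
      obtain i where i: "i \<in> {1..n}" "cmod (cis (\<theta> i) - complex_of_real s * \<i>) > \<delta>"
        using \<theta> s(1) by (fastforce simp: not_le)
      have "\<theta> \<in> B (i, s)"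
        using \<theta> s(2,3)[OF i(1)] i(2) by (simp add: B_def sets)
      moreover have "(i, s) \<in> I" using i(1) s(1) by (auto simp: I_def)
      ultimately show ?thesis by blast
    qed simp
  qed
  then have "measure ?P (space ?P - ?E) \<le> measure ?P (B0 \<union> (\<Union>p\<in>I. B p))"
    using B0 B by (intro finite_measure_mono) (auto simp: sets I_def intro!: sets.Un sets.finite_UN)
  also have "\<dots> \<le> measure ?P B0 + measure ?P (\<Union>p\<in>I. B p)"
    using B0 B by (intro measure_Un_le) (auto simp: sets I_def intro!: sets.finite_UN)
  also have "measure ?P (\<Union>p\<in>I. B p) \<le> (\<Sum>p\<in>I. measure ?P (B p))"
    using B by (intro finite_measure_subadditive_finite) (auto simp: sets I_def)
  also have "\<dots> \<le> (\<Sum>p\<in>I. ?\<eta>)"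
    using \<open>\<And>p. p \<in> I \<Longrightarrow> measure ?P (B p) \<le> ?\<eta>\<close> by (rule sum_mono)
  also have "\<dots> = 2 * n * ?\<eta>"
    by (simp add: I_def card_cartesian_product)
  finally have "measure ?P (space ?P - ?E) \<le> ?\<zeta> + 2 * n * ?\<eta>"
    using \<open>measure ?P B0 \<le> ?\<zeta>\<close> by linarith
  then show ?thesis
    using prob_compl[of ?E] E unfolding sets(1) by linarith
qed

theorem theorem1p1:
  fixes \<beta> :: real
  assumes "\<beta> > 0"
  shows "\<forall>\<epsilon>\<in>{0<..<1/14::real}. \<exists>c>0. \<forall>\<^sub>F n :: nat in sequentially.
    measure (mirror_process \<beta> n)
      {\<theta> \<in> space (mirror_process \<beta> n).
         (\<forall>j\<in>{1..n}. cmod (cis (\<theta> j) - \<i>) \<le> real n powr (- 1/2 + \<epsilon>)) \<or>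
         (\<forall>j\<in>{1..n}. cmod (cis (\<theta> j) + \<i>) \<le> real n powr (- 1/2 + \<epsilon>))}
    \<ge> 1 - exp (- c * real n powr (2 * \<epsilon>))"
proof (intro ballI exI conjI)
  fix \<epsilon> :: real assume "\<epsilon> \<in> {0<..<1/14}"
  then have e: "0 < \<epsilon>" "\<epsilon> < 1/14" by auto
  \<comment> \<open>The constant is half of the \<beta>/32 in the slice bound; the other half
    absorbs polynomial factors and lower-order exponents.\<close>
  show "\<beta> / 64 > 0" using assms by simp
  have "\<forall>\<^sub>F n :: nat in sequentially. n \<ge> 2" by (rule eventually_ge_at_top)
  moreover have "\<forall>\<^sub>F n :: nat in sequentially. real n powr \<epsilon> \<ge> 4"
    using e by real_asymp
  moreover have "\<forall>\<^sub>F n :: nat in sequentially. real n powr \<epsilon> + 1 \<le> real n"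
    using e by real_asymp
  moreover have "\<forall>\<^sub>F n :: nat in sequentially. sqrt (real n powr \<epsilon> * real n) + 1 \<le> real n"
    using e by real_asymp
  \<comment> \<open>From here on K is n^\<epsilon> and \<delta> is n^(-1/2 + \<epsilon>), so n
    \<delta>^2 = n^(2 \<epsilon>). Here n^((1 + \<epsilon>)/2) is compared with n^(1/2 +
    \<epsilon>).\<close>
  moreover have "\<forall>\<^sub>F n :: nat in sequentially.
      sqrt (real n powr \<epsilon> * real n) + 1 \<le> real n * (real n powr (- 1/2 + \<epsilon>)) / 16"
    using e by real_asymp
  moreover have "\<forall>\<^sub>F n :: nat in sequentially.
      real n powr \<epsilon> + 1 \<le> real n * (real n powr (- 1/2 + \<epsilon>))\<^sup>2 / 16"
    using e by real_asymp
  \<comment> \<open>The spread term: n^(1 + \<epsilon>) dominates both n log n and n^(2 \<epsilon>).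
    Each of the two error terms gets half of the target.\<close>
  moreover have "\<forall>\<^sub>F n :: nat in sequentially.
      (2 * pi * real n) ^ n * exp (2 * \<beta> - \<beta> * real n powr \<epsilon> * real n / 16)
        \<le> exp (- (\<beta> / 64) * real n powr (2 * \<epsilon>)) / 2"
    using e assms by real_asymp
  \<comment> \<open>The coordinate terms: n^(2 \<epsilon>) dominates n^\<epsilon> log n, so the
    Gaussian decay outweighs the cost of avoiding the zeros.\<close>
  moreover have "\<forall>\<^sub>F n :: nat in sequentially.
      2 * real n * (4 * pi * real n * exp (\<beta> * ln (1024 * real n ^ 4) * (real n powr \<epsilon> + 1 + 1) / 2
          - \<beta> * real n * (real n powr (- 1/2 + \<epsilon>))\<^sup>2 / 32))
        \<le> exp (- (\<beta> / 64) * real n powr (2 * \<epsilon>)) / 2"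
    using e assms by real_asymp
  ultimately show "\<forall>\<^sub>F n :: nat in sequentially.
    measure (mirror_process \<beta> n)
      {\<theta> \<in> space (mirror_process \<beta> n).
         (\<forall>j\<in>{1..n}. cmod (cis (\<theta> j) - \<i>) \<le> real n powr (- 1/2 + \<epsilon>)) \<or>
         (\<forall>j\<in>{1..n}. cmod (cis (\<theta> j) + \<i>) \<le> real n powr (- 1/2 + \<epsilon>))}
    \<ge> 1 - exp (- (\<beta> / 64) * real n powr (2 * \<epsilon>))"
  proof eventually_elim
    case (elim n)
    have "real n powr (- 1/2 + \<epsilon>) > 0" using elim(1) by simp
    from mirror_process_prob_ge[OF _ elim(1,2) this elim(3-6), of \<beta>] assms elim(7,8)
    show ?case by linarith
  qed
qed

end
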